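(* The two-dimensional sphere $S^2$ does not carry any non-Riemannian Finsler metric admitting a compatible linear connection.
   Context: A Finsler metric on a manifold $M$ is a continuous function $F\colon TM\to\mathbb{R}$, smooth off the zero section, with $F(tv)=tF(v)$ for $t>0$, such that with $E=\frac12F^2$ the Hessian $g_{ij}=\partial^2E/\partial y^i\partial y^j$ (with respect to the fibre coordinates $y^i$) is positive definite at all nonzero vectors. It is Riemannian if $F$ is the norm of a Riemannian metric, non-Riemannian otherwise. A linear connection on $M$ (not necessarily torsion-free) is compatible with $F$ if its parallel transports preserve the Finslerian length $F$ of tangent vectors.
   Formalization: A Finsler metric is additionally required to be nonnegative (F ≥ 0); without this the negative of the round norm, with the Levi-Civita connection, would be a counterexample. *)

theory Defs
  imports "HOL-Analysis.Analysis"
begin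

section \<open>Smooth maps\<close>

text \<open>For open \<open>U\<close>, \<open>Ck_on k U f\<close> says that \<open>f\<close> is of class \<open>C\<^sup>k\<close> on \<open>U\<close>: all iterated
  directional derivatives up to order \<open>k\<close> exist and are continuous.\<close>

primrec Ck_on ::
  "nat \<Rightarrow> 'a::euclidean_space set \<Rightarrow> ('a \<Rightarrow> 'b::euclidean_space) \<Rightarrow> bool" where
  "Ck_on 0 U f \<longleftrightarrow> continuous_on U f"
| "Ck_on (Suc k) U f \<longleftrightarrow>
     (\<forall>x\<in>U. f differentiable (at x)) \<and> (\<forall>v. Ck_on k U (\<lambda>x. frechet_derivative f (at x) v))"

text \<open>Smoothness on an arbitrary subset is the existence of smooth extensions locally in the ambient
  space; on an embedded submanifold this is smoothness with respect to the submanifold structure,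
  and on a compact interval it is smoothness up to the end points.\<close>

definition smooth_on ::
  "'a::euclidean_space set \<Rightarrow> ('a \<Rightarrow> 'b::euclidean_space) \<Rightarrow> bool" where
  "smooth_on S f \<longleftrightarrow>
     (\<forall>x\<in>S. \<exists>U g. open U \<and> x \<in> U \<and> (\<forall>k. Ck_on k U g) \<and> (\<forall>y\<in>S \<inter> U. g y = f y))"


section \<open>The sphere and its tangent bundle\<close>

abbreviation S2 :: "(real^3) set" where
  "S2 \<equiv> sphere 0 1"

definition tangent :: "real^3 \<Rightarrow> (real^3) set" where
  "tangent p = {v. p \<bullet> v = 0}"

definition TS2 :: "((real^3) \<times> (real^3)) set" where
  "TS2 = {(p, v). p \<in> S2 \<and> v \<in> tangent p}"

definition slit_TS2 :: "((real^3) \<times> (real^3)) set" where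
  "slit_TS2 = {(p, v). p \<in> S2 \<and> v \<in> tangent p \<and> v \<noteq> 0}"

text \<open>Vector fields are total functions of the ambient space of which only the values on the sphere
  matter.\<close>

definition vector_field :: "(real^3 \<Rightarrow> real^3) \<Rightarrow> bool" where
  "vector_field X \<longleftrightarrow> (\<forall>p\<in>S2. X p \<in> tangent p) \<and> smooth_on S2 X"


section \<open>Finsler and Riemannian metrics\<close>

text \<open>The Hessian of \<open>E = F\<^sup>2 / 2\<close> along the fibre over \<open>p\<close>, at \<open>y\<close>, applied to \<open>u\<close> and \<open>w\<close>. In linear
  coordinates \<open>y\<^sup>i\<close> of the fibre it is \<open>\<Sum>i j. (\<partial>\<^sup>2E / \<partial>y\<^sup>i\<partial>y\<^sup>j) u\<^sup>i w\<^sup>j\<close>.\<close>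

definition fibre_hessian ::
  "((real^3) \<times> (real^3) \<Rightarrow> real) \<Rightarrow> real^3 \<Rightarrow> real^3 \<Rightarrow> real^3 \<Rightarrow> real^3 \<Rightarrow> real" where
  "fibre_hessian F p y u w =
     deriv (\<lambda>s. deriv (\<lambda>t. (F (p, y + s *\<^sub>R u + t *\<^sub>R w))\<^sup>2 / 2) 0) 0"

text \<open>A Finsler metric measures lengths, so it is nonnegative. This is a separate condition, because the
  other conditions do not distinguish \<open>F\<close> from \<open>- F\<close>.\<close>

definition finsler_metric :: "((real^3) \<times> (real^3) \<Rightarrow> real) \<Rightarrow> bool" where
  "finsler_metric F \<longleftrightarrow>
     continuous_on TS2 F \<and>
     smooth_on slit_TS2 F \<and>
     (\<forall>(p, v)\<in>TS2. F (p, v) \<ge> 0) \<and>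
     (\<forall>(p, v)\<in>TS2. \<forall>t>0. F (p, t *\<^sub>R v) = t * F (p, v)) \<and>
     (\<forall>(p, y)\<in>slit_TS2. \<forall>w\<in>tangent p. w \<noteq> 0 \<longrightarrow> fibre_hessian F p y w w > 0)"

definition riemannian_metric :: "(real^3 \<Rightarrow> real^3 \<Rightarrow> real^3 \<Rightarrow> real) \<Rightarrow> bool" where
  "riemannian_metric g \<longleftrightarrow>
     (\<forall>p\<in>S2. \<forall>u\<in>tangent p. \<forall>v\<in>tangent p. \<forall>w\<in>tangent p. \<forall>c d.
        g p (c *\<^sub>R u + d *\<^sub>R v) w = c * g p u w + d * g p v w) \<and>
     (\<forall>p\<in>S2. \<forall>v\<in>tangent p. \<forall>w\<in>tangent p. g p v w = g p w v) \<and>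
     (\<forall>p\<in>S2. \<forall>v\<in>tangent p. v \<noteq> 0 \<longrightarrow> g p v v > 0) \<and>
     (\<forall>X Y. vector_field X \<and> vector_field Y \<longrightarrow> smooth_on S2 (\<lambda>p. g p (X p) (Y p)))"

definition riemannian :: "((real^3) \<times> (real^3) \<Rightarrow> real) \<Rightarrow> bool" where
  "riemannian F \<longleftrightarrow>
     (\<exists>g. riemannian_metric g \<and> (\<forall>(p, v)\<in>TS2. F (p, v) = sqrt (g p v v)))"


section \<open>Linear connections\<close>

text \<open>\<open>nabla Y p v\<close> is the covariant derivative at \<open>p\<close> of the vector field \<open>Y\<close> in the direction of the
  tangent vector \<open>v\<close>. In the Leibniz rule, a derivative \<open>f'\<close> of \<open>f\<close> within the sphere is determined on
  tangent vectors, where it is the differential of \<open>f\<close>; no condition is imposed on the torsion.\<close>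

definition linear_connection ::
  "((real^3 \<Rightarrow> real^3) \<Rightarrow> real^3 \<Rightarrow> real^3 \<Rightarrow> real^3) \<Rightarrow> bool" where
  "linear_connection nabla \<longleftrightarrow>
     (\<forall>Y p v. vector_field Y \<and> p \<in> S2 \<and> v \<in> tangent p \<longrightarrow> nabla Y p v \<in> tangent p) \<and>
     (\<forall>X Y. vector_field X \<and> vector_field Y \<longrightarrow> smooth_on S2 (\<lambda>p. nabla Y p (X p))) \<and>
     (\<forall>Y Z p v. vector_field Y \<and> vector_field Z \<and> (\<forall>q\<in>S2. Y q = Z q) \<and> p \<in> S2 \<and> v \<in> tangent p \<longrightarrow>
        nabla Y p v = nabla Z p v) \<and>
     (\<forall>Y p u v c d. vector_field Y \<and> p \<in> S2 \<and> u \<in> tangent p \<and> v \<in> tangent p \<longrightarrow>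
        nabla Y p (c *\<^sub>R u + d *\<^sub>R v) = c *\<^sub>R nabla Y p u + d *\<^sub>R nabla Y p v) \<and>
     (\<forall>Y Z p v. vector_field Y \<and> vector_field Z \<and> p \<in> S2 \<and> v \<in> tangent p \<longrightarrow>
        nabla (\<lambda>q. Y q + Z q) p v = nabla Y p v + nabla Z p v) \<and>
     (\<forall>(f :: real^3 \<Rightarrow> real) f' Y p v.
        smooth_on S2 f \<and> vector_field Y \<and> p \<in> S2 \<and> v \<in> tangent p \<and>
        (f has_derivative f') (at p within S2) \<longrightarrow>
        nabla (\<lambda>q. f q *\<^sub>R Y q) p v = f' v *\<^sub>R Y p + f p *\<^sub>R nabla Y p v)"


section \<open>Parallel transport\<close>

text \<open>The sphere has no global frame, but the tangential projections \<open>frame i\<close> of the three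
  standard basis vectors span every tangent space, and each \<open>v \<in> tangent p\<close> is \<open>\<Sum>i. v $ i *\<^sub>R frame i p\<close>.\<close>

definition frame :: "3 \<Rightarrow> real^3 \<Rightarrow> real^3" where
  "frame i p = axis i 1 - (p $ i) *\<^sub>R p"

definition smooth_curve :: "real \<Rightarrow> real \<Rightarrow> (real \<Rightarrow> real^3) \<Rightarrow> bool" where
  "smooth_curve a b \<gamma> \<longleftrightarrow> a < b \<and> smooth_on {a..b} \<gamma> \<and> \<gamma> ` {a..b} \<subseteq> S2"

definition field_along :: "real \<Rightarrow> real \<Rightarrow> (real \<Rightarrow> real^3) \<Rightarrow> (real \<Rightarrow> real^3) \<Rightarrow> bool" where
  "field_along a b \<gamma> V \<longleftrightarrow> smooth_on {a..b} V \<and> (\<forall>t\<in>{a..b}. V t \<in> tangent (\<gamma> t))"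

text \<open>The covariant derivative of \<open>V = \<Sum>i. V\<^sub>i (frame i \<circ> \<gamma>)\<close> along \<open>\<gamma>\<close>, as the Leibniz rule
  prescribes it: \<open>\<Sum>i. V\<^sub>i' (frame i \<circ> \<gamma>) + V\<^sub>i \<nabla>\<^sub>\<gamma>\<^sub>' (frame i)\<close>.\<close>

definition covariant_derivative_along ::
  "((real^3 \<Rightarrow> real^3) \<Rightarrow> real^3 \<Rightarrow> real^3 \<Rightarrow> real^3) \<Rightarrow> real \<Rightarrow> real \<Rightarrow>
   (real \<Rightarrow> real^3) \<Rightarrow> (real \<Rightarrow> real^3) \<Rightarrow> real \<Rightarrow> real^3" where
  "covariant_derivative_along nabla a b \<gamma> V t =
     (\<Sum>i\<in>UNIV. (vector_derivative V (at t within {a..b}) $ i) *\<^sub>R frame i (\<gamma> t) +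
        (V t $ i) *\<^sub>R nabla (frame i) (\<gamma> t) (vector_derivative \<gamma> (at t within {a..b})))"

definition parallel_along ::
  "((real^3 \<Rightarrow> real^3) \<Rightarrow> real^3 \<Rightarrow> real^3 \<Rightarrow> real^3) \<Rightarrow> real \<Rightarrow> real \<Rightarrow>
   (real \<Rightarrow> real^3) \<Rightarrow> (real \<Rightarrow> real^3) \<Rightarrow> bool" where
  "parallel_along nabla a b \<gamma> V \<longleftrightarrow>
     field_along a b \<gamma> V \<and> (\<forall>t\<in>{a..b}. covariant_derivative_along nabla a b \<gamma> V t = 0)"

text \<open>The graph of the parallel transport \<open>tangent (\<gamma> a) \<rightarrow> tangent (\<gamma> b)\<close>.\<close>

definition parallel_transport ::
  "((real^3 \<Rightarrow> real^3) \<Rightarrow> real^3 \<Rightarrow> real^3 \<Rightarrow> real^3) \<Rightarrow> real \<Rightarrow> real \<Rightarrow>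
   (real \<Rightarrow> real^3) \<Rightarrow> real^3 \<Rightarrow> real^3 \<Rightarrow> bool" where
  "parallel_transport nabla a b \<gamma> v w \<longleftrightarrow>
     (\<exists>V. parallel_along nabla a b \<gamma> V \<and> V a = v \<and> V b = w)"

definition compatible ::
  "((real^3 \<Rightarrow> real^3) \<Rightarrow> real^3 \<Rightarrow> real^3 \<Rightarrow> real^3) \<Rightarrow> ((real^3) \<times> (real^3) \<Rightarrow> real) \<Rightarrow> bool" where
  "compatible nabla F \<longleftrightarrow>
     (\<forall>a b \<gamma> v w. smooth_curve a b \<gamma> \<and> parallel_transport nabla a b \<gamma> v w \<longrightarrow>
        F (\<gamma> b, w) = F (\<gamma> a, v))"


section \<open>Covariant derivatives along curves extend the connection\<close>

lemma frame_expansion: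
  assumes "v \<in> tangent p"
  shows "(\<Sum>i\<in>UNIV. (v $ i) *\<^sub>R frame i p) = v"
proof -
  have "(\<Sum>i\<in>UNIV. (v $ i) *\<^sub>R frame i p) =
      (\<Sum>i\<in>UNIV. (v $ i) *\<^sub>R axis i 1) - (\<Sum>i\<in>UNIV. (v $ i) * (p $ i)) *\<^sub>R p"
    by (simp add: frame_def scaleR_diff_right sum_subtractf scaleR_sum_left)
  moreover have "(\<Sum>i\<in>UNIV. (v $ i) *\<^sub>R axis i (1::real)) = v"
    using basis_expansion[of v] by (simp add: scalar_mult_eq_scaleR)
  moreover have "(\<Sum>i\<in>UNIV. (v $ i) * (p $ i)) = 0"
    using assms by (simp add: tangent_def inner_vec_def mult.commute)
  ultimately show ?thesis by simp
qed

lemma Ck_on_cong: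
  assumes "open U" "\<And>x. x \<in> U \<Longrightarrow> f x = g x"
  shows "Ck_on k U f \<longleftrightarrow> Ck_on k U g"
  using assms(2)
proof (induction k arbitrary: f g)
  case 0
  then show ?case by (simp cong: continuous_on_cong)
next
  case (Suc k)
  have *: "(f has_derivative D) (at x) \<longleftrightarrow> (g has_derivative D) (at x)" if "x \<in> U" for x D
    using has_derivative_transform_within_open[OF _ assms(1) that, of f D UNIV g]
      has_derivative_transform_within_open[OF _ assms(1) that, of g D UNIV f] Suc.prems
    by auto
  have "frechet_derivative f (at x) = frechet_derivative g (at x)" if "x \<in> U" for x
    using *[OF that] by (simp add: frechet_derivative_def)
  then have "Ck_on k U (\<lambda>x. frechet_derivative f (at x) v) \<longleftrightarrow>
      Ck_on k U (\<lambda>x. frechet_derivative g (at x) v)" for v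
    by (intro Suc.IH) simp
  then show ?case using * by (auto simp: differentiable_def)
qed

lemma Ck_on_SucD: "Ck_on (Suc k) U f \<Longrightarrow> Ck_on k U f"
proof (induction k arbitrary: f)
  case 0
  then show ?case
    by (auto intro!: continuous_at_imp_continuous_on differentiable_imp_continuous_within)
qed auto

lemma Ck_on_subset: "Ck_on k U f \<Longrightarrow> W \<subseteq> U \<Longrightarrow> Ck_on k W f"
  by (induction k arbitrary: f) (auto intro: continuous_on_subset)

lemma Ck_on_const: "Ck_on k U (\<lambda>x. c)"
  by (induction k arbitrary: c) (auto simp: frechet_derivative_const)

lemma Ck_on_bounded_linear:
  assumes "bounded_linear h"
  shows "Ck_on k U h"
  using assms
  by (cases k) (auto simp: Ck_on_const
      frechet_derivative_at[OF bounded_linear_imp_has_derivative, symmetric]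
      intro: linear_continuous_on bounded_linear_imp_differentiable)

lemma Ck_on_add:
  assumes "open U" "Ck_on k U f" "Ck_on k U g"
  shows "Ck_on k U (\<lambda>x. f x + g x)"
  using assms(2,3)
proof (induction k arbitrary: f g)
  case 0
  then show ?case by (auto intro: continuous_intros)
next
  case (Suc k)
  have D: "((\<lambda>x. f x + g x) has_derivative
      (\<lambda>v. frechet_derivative f (at x) v + frechet_derivative g (at x) v)) (at x)" if "x \<in> U" for x
    using Suc.prems that
    by (auto intro!: has_derivative_add simp: frechet_derivative_works[symmetric])
  have "Ck_on k U (\<lambda>x. frechet_derivative (\<lambda>x. f x + g x) (at x) v)" for v
    using Suc.IH[of "\<lambda>x. frechet_derivative f (at x) v" "\<lambda>x. frechet_derivative g (at x) v"] Suc.prems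
    by (subst Ck_on_cong[OF assms(1)]) (auto simp: frechet_derivative_at[OF D, symmetric])
  then show ?case using D by (auto simp: differentiable_def)
qed

lemma Ck_on_scaleR:
  fixes f :: "'a::euclidean_space \<Rightarrow> real"
  assumes "open U" "Ck_on k U f" "Ck_on k U g"
  shows "Ck_on k U (\<lambda>x. f x *\<^sub>R g x)"
  using assms(2,3)
proof (induction k arbitrary: f g)
  case 0
  then show ?case by (auto intro: continuous_intros)
next
  case (Suc k)
  have D: "((\<lambda>x. f x *\<^sub>R g x) has_derivative
      (\<lambda>v. f x *\<^sub>R frechet_derivative g (at x) v + frechet_derivative f (at x) v *\<^sub>R g x)) (at x)"
    if "x \<in> U" for x
    using Suc.prems that
    by (auto intro!: has_derivative_scaleR simp: frechet_derivative_works[symmetric])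
  have "Ck_on k U (\<lambda>x. frechet_derivative (\<lambda>x. f x *\<^sub>R g x) (at x) v)" for v
  proof -
    have "Ck_on k U (\<lambda>x. f x *\<^sub>R frechet_derivative g (at x) v + frechet_derivative f (at x) v *\<^sub>R g x)"
      using Suc.prems Ck_on_SucD[OF Suc.prems(1)] Ck_on_SucD[OF Suc.prems(2)]
      by (intro Ck_on_add[OF assms(1)] Suc.IH) auto
    then show ?thesis
      by (subst Ck_on_cong[OF assms(1)]) (auto simp: frechet_derivative_at[OF D, symmetric])
  qed
  then show ?case using D by (auto simp: differentiable_def)
qed

lemma Ck_on_linear_comp:
  assumes "open U" "bounded_linear h" "Ck_on k U f"
  shows "Ck_on k U (\<lambda>x. h (f x))"
  using assms(3)
proof (induction k arbitrary: f)
  case 0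
  then show ?case
    using bounded_linear.continuous_on[OF assms(2)] by auto
next
  case (Suc k)
  have D: "((\<lambda>x. h (f x)) has_derivative (\<lambda>v. h (frechet_derivative f (at x) v))) (at x)"
    if "x \<in> U" for x
    using Suc.prems that
    by (auto intro!: bounded_linear.has_derivative[OF assms(2)]
        simp: frechet_derivative_works[symmetric])
  have "Ck_on k U (\<lambda>x. frechet_derivative (\<lambda>x. h (f x)) (at x) v)" for v
    using Suc.IH[of "\<lambda>x. frechet_derivative f (at x) v"] Suc.prems
    by (subst Ck_on_cong[OF assms(1)]) (auto simp: frechet_derivative_at[OF D, symmetric])
  then show ?case using D by (auto simp: differentiable_def)
qed

lemma smooth_on_bounded_linear: "bounded_linear h \<Longrightarrow> smooth_on S h"
  unfolding smooth_on_def using Ck_on_bounded_linear open_UNIV by blast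

lemma smooth_on_const: "smooth_on S (\<lambda>x. c)"
  unfolding smooth_on_def using Ck_on_const open_UNIV by blast

lemma smooth_on_linear_comp:
  assumes "bounded_linear h" "smooth_on S f"
  shows "smooth_on S (\<lambda>x. h (f x))"
  unfolding smooth_on_def
proof
  fix x assume "x \<in> S"
  then obtain U g where U: "open U" "x \<in> U" "\<forall>k. Ck_on k U g" "\<forall>y\<in>S \<inter> U. g y = f y"
    using assms(2) unfolding smooth_on_def by meson
  have "Ck_on k U (\<lambda>x. h (g x))" for k
    using U by (intro Ck_on_linear_comp[OF _ assms(1)]) auto
  then show "\<exists>U g. open U \<and> x \<in> U \<and> (\<forall>k. Ck_on k U g) \<and> (\<forall>y\<in>S \<inter> U. g y = h (f y))"
    using U by (intro exI[of _ U] exI[of _ "\<lambda>x. h (g x)"]) auto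
qed

lemma smooth_on_add:
  assumes "smooth_on S f" "smooth_on S g"
  shows "smooth_on S (\<lambda>x. f x + g x)"
  unfolding smooth_on_def
proof
  fix x assume x: "x \<in> S"
  obtain U f' where U: "open U" "x \<in> U" "\<forall>k. Ck_on k U f'" "\<forall>y\<in>S \<inter> U. f' y = f y"
    using x assms(1) unfolding smooth_on_def by meson
  obtain W g' where W: "open W" "x \<in> W" "\<forall>k. Ck_on k W g'" "\<forall>y\<in>S \<inter> W. g' y = g y"
    using x assms(2) unfolding smooth_on_def by meson
  have "Ck_on k (U \<inter> W) (\<lambda>x. f' x + g' x)" for k
    using U W by (intro Ck_on_add) (auto intro: Ck_on_subset)
  then show "\<exists>U h. open U \<and> x \<in> U \<and> (\<forall>k. Ck_on k U h) \<and> (\<forall>y\<in>S \<inter> U. h y = f y + g y)"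
    using U W by (intro exI[of _ "U \<inter> W"] exI[of _ "\<lambda>x. f' x + g' x"]) auto
qed

lemma smooth_on_scaleR:
  fixes f :: "'a::euclidean_space \<Rightarrow> real"
  assumes "smooth_on S f" "smooth_on S g"
  shows "smooth_on S (\<lambda>x. f x *\<^sub>R g x)"
  unfolding smooth_on_def
proof
  fix x assume x: "x \<in> S"
  obtain U f' where U: "open U" "x \<in> U" "\<forall>k. Ck_on k U f'" "\<forall>y\<in>S \<inter> U. f' y = f y"
    using x assms(1) unfolding smooth_on_def by meson
  obtain W g' where W: "open W" "x \<in> W" "\<forall>k. Ck_on k W g'" "\<forall>y\<in>S \<inter> W. g' y = g y"
    using x assms(2) unfolding smooth_on_def by meson
  have "Ck_on k (U \<inter> W) (\<lambda>x. f' x *\<^sub>R g' x)" for k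
    using U W by (intro Ck_on_scaleR) (auto intro: Ck_on_subset)
  then show "\<exists>U h. open U \<and> x \<in> U \<and> (\<forall>k. Ck_on k U h) \<and> (\<forall>y\<in>S \<inter> U. h y = f y *\<^sub>R g y)"
    using U W by (intro exI[of _ "U \<inter> W"] exI[of _ "\<lambda>x. f' x *\<^sub>R g' x"]) auto
qed

lemma smooth_on_has_derivative:
  assumes "smooth_on S f" "x \<in> S"
  shows "\<exists>f'. (f has_derivative f') (at x within S)"
proof -
  obtain U g where U: "open U" "x \<in> U" "\<forall>k. Ck_on k U g" "\<forall>y\<in>S \<inter> U. g y = f y"
    using assms unfolding smooth_on_def by meson
  have "Ck_on (Suc 0) U g"
    using U(3) by blast
  then obtain f' where "(g has_derivative f') (at x)"
    using U(2) by (auto simp: differentiable_def)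
  then have "(g has_derivative f') (at x within S)"
    by (rule has_derivative_at_withinI)
  moreover obtain d where "d > 0" "ball x d \<subseteq> U"
    using U(1,2) openE by blast
  ultimately have "(f has_derivative f') (at x within S)"
    using U(4) assms(2)
    by (elim has_derivative_transform_within[where d = d]) (auto simp: dist_commute subset_iff)
  then show ?thesis by blast
qed

lemma vector_field_frame: "vector_field (frame i)"
proof -
  have "frame i p \<in> tangent p" if "p \<in> S2" for p
    using that by (simp add: frame_def tangent_def inner_diff_right inner_axis norm_eq_1)
  moreover have "smooth_on S2 (frame i)"
  proof -
    have "smooth_on S2 (\<lambda>p::real^3. axis i 1 + (- (p $ i)) *\<^sub>R p)"
      by (intro smooth_on_add smooth_on_scaleR smooth_on_const smooth_on_bounded_linear
          bounded_linear_minus bounded_linear_vec_nth bounded_linear_ident)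
    then show ?thesis
      by (simp add: frame_def[abs_def])
  qed
  ultimately show ?thesis by (simp add: vector_field_def)
qed

lemma vector_field_add:
  "vector_field X \<Longrightarrow> vector_field Y \<Longrightarrow> vector_field (\<lambda>p. X p + Y p)"
  by (auto simp: vector_field_def tangent_def inner_add_right intro: smooth_on_add)

lemma vector_field_scaleR:
  "smooth_on S2 f \<Longrightarrow> vector_field Y \<Longrightarrow> vector_field (\<lambda>p. f p *\<^sub>R Y p)"
  by (auto simp: vector_field_def tangent_def intro: smooth_on_scaleR)

theorem covariant_derivative_along_vector_field:
  assumes nabla: "linear_connection nabla" and \<gamma>: "smooth_curve a b \<gamma>"
    and Y: "vector_field Y" and t: "t \<in> {a..b}"
  shows "covariant_derivative_along nabla a b \<gamma> (Y \<circ> \<gamma>) t =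
    nabla Y (\<gamma> t) (vector_derivative \<gamma> (at t within {a..b}))"
proof -
  define p where "p = \<gamma> t"
  define v where "v = vector_derivative \<gamma> (at t within {a..b})"
  have ab: "a < b" and p: "p \<in> S2" and S2: "\<gamma> ` {a..b} \<subseteq> S2"
    using \<gamma> t by (auto simp: smooth_curve_def p_def image_subset_iff)
  have nontriv: "at t within {a..b} \<noteq> bot"
    using ab t by (simp add: trivial_limit_within islimpt_Icc)
  obtain D where "(\<gamma> has_derivative D) (at t within {a..b})"
    using smooth_on_has_derivative \<gamma> t unfolding smooth_curve_def by blast
  then have d\<gamma>: "(\<gamma> has_vector_derivative v) (at t within {a..b})"
    unfolding v_def by (metis differentiableI vector_derivative_works)
  obtain Y' where Y': "(Y has_derivative Y') (at p within S2)"
    using smooth_on_has_derivative Y p unfolding vector_field_def by blast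
  have "((Y \<circ> \<gamma>) has_vector_derivative Y' v) (at t within {a..b})"
    using vector_derivative_diff_chain_within[OF d\<gamma>, of Y Y'] has_derivative_subset[OF Y' S2]
    by (simp add: p_def)
  then have dY: "vector_derivative (Y \<circ> \<gamma>) (at t within {a..b}) = Y' v"
    using vector_derivative_within[OF nontriv] by blast
  have tangent_v: "v \<in> tangent p"
  proof -
    have "((\<lambda>s. \<gamma> s \<bullet> \<gamma> s) has_vector_derivative (\<gamma> t \<bullet> v + v \<bullet> \<gamma> t)) (at t within {a..b})"
      using d\<gamma> by (auto simp: has_vector_derivative_def algebra_simps
          intro!: derivative_eq_intros)
    moreover have "((\<lambda>s. \<gamma> s \<bullet> \<gamma> s) has_vector_derivative 0) (at t within {a..b})"
      using S2 t by (intro has_vector_derivative_transform[OF t _ has_vector_derivative_const[of 1]])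
        (auto simp: norm_eq_1 image_subset_iff)
    ultimately have "\<gamma> t \<bullet> v + v \<bullet> \<gamma> t = 0"
      using vector_derivative_within[OF nontriv] by metis
    then show ?thesis
      by (simp add: tangent_def p_def inner_commute)
  qed
  let ?c = "\<lambda>i q. (Y q $ i) *\<^sub>R frame i q"
  have smooth_c: "smooth_on S2 (\<lambda>q. Y q $ i)" for i
    using Y by (intro smooth_on_linear_comp[OF bounded_linear_vec_nth]) (simp add: vector_field_def)
  have vf_c: "vector_field (?c i)" for i
    by (intro vector_field_scaleR smooth_c vector_field_frame)
  have dc: "((\<lambda>q. Y q $ i) has_derivative (\<lambda>u. Y' u $ i)) (at p within S2)" for i
    using bounded_linear.has_derivative[OF bounded_linear_vec_nth Y'] .
  have rule: "nabla (\<lambda>q. f q *\<^sub>R Z q) p v = f' v *\<^sub>R Z p + f p *\<^sub>R nabla Z p v"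
    if "smooth_on S2 f" "vector_field Z" "(f has_derivative f') (at p within S2)" for f f' Z
    using nabla that p tangent_v unfolding linear_connection_def by blast
  have leibniz: "nabla (?c i) p v = (Y' v $ i) *\<^sub>R frame i p + (Y p $ i) *\<^sub>R nabla (frame i) p v"
    for i
    by (rule rule[OF smooth_c vector_field_frame dc])
  have "nabla Y p v = nabla (\<lambda>q. \<Sum>i\<in>UNIV. ?c i q) p v"
  proof -
    have "vector_field (\<lambda>q. \<Sum>i\<in>UNIV. ?c i q)"
      unfolding sum_3 by (intro vector_field_add vf_c)
    moreover have "\<forall>q\<in>S2. Y q = (\<Sum>i\<in>UNIV. ?c i q)"
      using Y by (simp add: vector_field_def frame_expansion)
    moreover have "nabla Y p v = nabla Z p v" if "vector_field Z" "\<forall>q\<in>S2. Y q = Z q" for Z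
      using nabla that Y p tangent_v unfolding linear_connection_def by blast
    ultimately show ?thesis
      by blast
  qed
  also have "\<dots> = (\<Sum>i\<in>UNIV. nabla (?c i) p v)"
  proof -
    have add: "nabla (\<lambda>q. X q + Z q) p v = nabla X p v + nabla Z p v"
      if "vector_field X" "vector_field Z" for X Z
      using nabla that p tangent_v unfolding linear_connection_def by blast
    show ?thesis
      unfolding sum_3 by (simp only: add vector_field_add vf_c)
  qed
  finally show ?thesis
    by (simp add: leibniz covariant_derivative_along_def dY flip: p_def v_def)
qed

end

theory Submission
  imports Defs
begin

text \<open>A Finsler metric \<open>F\<close> with a compatible linear connection on the sphere is shown to be Riemannian.

  Parallel transport is linear and preserves \<open>F\<close>, so all the fibres \<open>F (p, _)\<close> are linearly
  equivalent to one gauge \<open>N\<close> on the plane (\<open>isometric_frame_exists\<close>). Let \<open>G\<close> be the group of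
  linear symmetries of \<open>N\<close>. There are two cases.

  If the identity is an accumulation point of \<open>G\<close>, then \<open>N\<close> is invariant under a nonzero linear
  vector field \<open>B\<close>, a limit of difference quotients of symmetries. With \<open>Q(u) = det (u, B u)\<close>, the
  function \<open>N\<^sup>2 / Q\<close> has vanishing differential, so \<open>N\<^sup>2\<close> is a multiple of the quadratic form \<open>Q\<close>
  (\<open>gauge_quadratic_if_symmetries_accumulate\<close>). Then \<open>F\<^sup>2\<close> is a quadratic form on every fibre, and
  polarisation yields a Riemannian metric (\<open>riemannian_if_quadratic\<close>).

  Otherwise \<open>G\<close> is discrete. The pairs of tangent vectors at \<open>p\<close> that identify \<open>N\<close> with
  \<open>F (p, _)\<close> form a torsor under \<open>G\<close>, and together they form a covering space of the sphere
  (\<open>iso_frames_separated\<close>, \<open>iso_frames_lift\<close>, \<open>covering_space_separated_fibres\<close>). As the sphere is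
  simply connected, this covering has a section, and the first vectors of its frames form a nowhere
  vanishing continuous tangent field, contrary to the hairy ball theorem (\<open>hairy_ball\<close>).

  The connection enters only through the existence of the linear equivalences. It is therefore enough
  to solve the linear differential equation of parallel transport along great circles, on intervals
  of a fixed length (\<open>ode_local_solution\<close>, \<open>great_circle_step\<close>). Uniqueness of solutions is not
  needed.\<close>

section \<open>Smooth maps\<close>

lemma Ck_on_local:
  assumes "\<And>x. x \<in> U \<Longrightarrow> \<exists>W. open W \<and> x \<in> W \<and> Ck_on k W f"
  shows "Ck_on k U f"
  using assms
proof (induction k arbitrary: f)
  case 0
  show ?case
    unfolding Ck_on.simps
  proof (rule continuous_at_imp_continuous_on, rule ballI)
    fix x assume "x \<in> U"
    then obtain W where "open W" "x \<in> W" "continuous_on W f"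
      using "0.prems" by auto
    then show "isCont f x"
      by (simp add: continuous_on_eq_continuous_at)
  qed
next
  case (Suc k)
  have "f differentiable (at x)" if "x \<in> U" for x
    using Suc.prems[OF that] by auto
  moreover have "Ck_on k U (\<lambda>x. frechet_derivative f (at x) v)" for v
    using Suc.prems by (intro Suc.IH) force
  ultimately show ?case by simp
qed

lemma Ck_on_sum:
  assumes "open U" "finite A" "\<And>i. i \<in> A \<Longrightarrow> Ck_on k U (f i)"
  shows "Ck_on k U (\<lambda>x. \<Sum>i\<in>A. f i x)"
  using assms(2,3)
  by (induction A rule: finite_induct) (auto intro: Ck_on_const Ck_on_add[OF assms(1)])

lemma Ck_on_compose:
  fixes f :: "'a::euclidean_space \<Rightarrow> 'b::euclidean_space" and g :: "'b \<Rightarrow> 'c::euclidean_space"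
  assumes "open U" "open W" "Ck_on k U f" "Ck_on k W g" "f ` U \<subseteq> W"
  shows "Ck_on k U (\<lambda>x. g (f x))"
  using assms(3,4)
proof (induction k arbitrary: g)
  case 0
  then show ?case using assms(5) by (auto intro: continuous_on_compose2)
next
  case (Suc k)
  let ?D = "\<lambda>x v. frechet_derivative g (at (f x)) (frechet_derivative f (at x) v)"
  have D: "((\<lambda>x. g (f x)) has_derivative ?D x) (at x)" if "x \<in> U" for x
    using Suc.prems that assms(5)
    by (intro has_derivative_compose[of f _ x UNIV g]) (auto simp: frechet_derivative_works[symmetric])
  have "Ck_on k U (\<lambda>x. frechet_derivative (\<lambda>x. g (f x)) (at x) v)" for v
  proof -
    have expand: "?D x v = (\<Sum>b\<in>Basis. (frechet_derivative f (at x) v \<bullet> b) *\<^sub>R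
        frechet_derivative g (at (f x)) b)" if "x \<in> U" for x
    proof -
      have lin: "linear (frechet_derivative g (at (f x)))"
        using Suc.prems(2) that assms(5) by (intro linear_frechet_derivative) auto
      have "?D x v = frechet_derivative g (at (f x))
          (\<Sum>b\<in>Basis. (frechet_derivative f (at x) v \<bullet> b) *\<^sub>R b)"
        by (simp add: euclidean_representation)
      then show ?thesis
        by (simp add: linear_sum[OF lin] linear_scale[OF lin])
    qed
    have "Ck_on k U (\<lambda>x. \<Sum>b\<in>Basis. (frechet_derivative f (at x) v \<bullet> b) *\<^sub>R
        frechet_derivative g (at (f x)) b)"
    proof (intro Ck_on_sum Ck_on_scaleR assms(1) finite_Basis)
      fix b :: 'b
      show "Ck_on k U (\<lambda>x. frechet_derivative f (at x) v \<bullet> b)"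
        using Suc.prems(1) by (intro Ck_on_linear_comp[OF assms(1) bounded_linear_inner_left]) auto
      show "Ck_on k U (\<lambda>x. frechet_derivative g (at (f x)) b)"
        using Suc.prems Ck_on_SucD[OF Suc.prems(1)] by (intro Suc.IH) auto
    qed
    then show ?thesis
      by (subst Ck_on_cong[OF assms(1)]) (auto simp: frechet_derivative_at[OF D, symmetric] expand)
  qed
  then show ?case using D by (auto simp: differentiable_def)
qed

lemma smooth_on_local:
  assumes "\<And>x. x \<in> S \<Longrightarrow> \<exists>W. open W \<and> x \<in> W \<and> smooth_on (S \<inter> W) f"
  shows "smooth_on S f"
  unfolding smooth_on_def
proof
  fix x assume x: "x \<in> S"
  then obtain W where W: "open W" "x \<in> W" "smooth_on (S \<inter> W) f"
    using assms by blast
  then obtain U g where U: "open U" "x \<in> U" "\<forall>k. Ck_on k U g" "\<forall>y\<in>S \<inter> W \<inter> U. g y = f y"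
    using x unfolding smooth_on_def by (metis IntI)
  then show "\<exists>U g. open U \<and> x \<in> U \<and> (\<forall>k. Ck_on k U g) \<and> (\<forall>y\<in>S \<inter> U. g y = f y)"
    using W by (intro exI[of _ "U \<inter> W"] exI[of _ g]) (auto intro: Ck_on_subset)
qed

lemma smooth_on_cong:
  assumes "smooth_on S f" "\<And>x. x \<in> S \<Longrightarrow> f x = g x"
  shows "smooth_on S g"
  using assms unfolding smooth_on_def by (metis IntD1)

lemma smooth_on_subset:
  assumes "smooth_on S f" "T \<subseteq> S"
  shows "smooth_on T f"
  unfolding smooth_on_def
proof
  fix x assume "x \<in> T"
  then obtain U g where "open U" "x \<in> U" "\<forall>k. Ck_on k U g" "\<forall>y\<in>S \<inter> U. g y = f y"
    using assms unfolding smooth_on_def by (metis subsetD)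
  then show "\<exists>U g. open U \<and> x \<in> U \<and> (\<forall>k. Ck_on k U g) \<and> (\<forall>y\<in>T \<inter> U. g y = f y)"
    using assms(2) by (intro exI[of _ U] exI[of _ g]) auto
qed

lemma smooth_on_imp_continuous_on:
  assumes "smooth_on S f"
  shows "continuous_on S f"
  using smooth_on_has_derivative[OF assms] has_derivative_continuous
  by (metis continuous_on_eq_continuous_within)

lemma smooth_on_open_iff:
  assumes "open U"
  shows "smooth_on U f \<longleftrightarrow> (\<forall>k. Ck_on k U f)"
proof
  assume f: "smooth_on U f"
  show "\<forall>k. Ck_on k U f"
  proof (intro allI Ck_on_local)
    fix k x assume "x \<in> U"
    then obtain W g where W: "open W" "x \<in> W" "\<forall>k. Ck_on k W g" "\<forall>y\<in>U \<inter> W. g y = f y"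
      using f unfolding smooth_on_def by meson
    have "Ck_on k (U \<inter> W) f"
      using Ck_on_cong[of "U \<inter> W" g f k] W assms Ck_on_subset[of k W g "U \<inter> W"] by auto
    then show "\<exists>W. open W \<and> x \<in> W \<and> Ck_on k W f"
      using W assms \<open>x \<in> U\<close> by (intro exI[of _ "U \<inter> W"]) auto
  qed
qed (use assms in \<open>auto simp: smooth_on_def\<close>)

lemma smooth_on_compose:
  assumes "smooth_on S f" "smooth_on T g" "f ` S \<subseteq> T"
  shows "smooth_on S (\<lambda>x. g (f x))"
  unfolding smooth_on_def
proof
  fix x assume x: "x \<in> S"
  obtain U f' where U: "open U" "x \<in> U" "\<forall>k. Ck_on k U f'" "\<forall>y\<in>S \<inter> U. f' y = f y"
    using x assms(1) unfolding smooth_on_def by meson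
  obtain W g' where W: "open W" "f x \<in> W" "\<forall>k. Ck_on k W g'" "\<forall>y\<in>T \<inter> W. g' y = g y"
    using x assms(2,3) unfolding smooth_on_def by (metis image_subset_iff)
  define U' where "U' = U \<inter> f' -` W"
  have "continuous_on U f'"
    using U(3)[rule_format, of 0] by simp
  then have "open U'"
    using U(1) W(1) by (simp add: U'_def continuous_open_preimage)
  have "Ck_on k U' (\<lambda>x. g' (f' x))" for k
    by (rule Ck_on_compose[OF \<open>open U'\<close> W(1) Ck_on_subset[OF U(3)[rule_format]] W(3)[rule_format]])
      (auto simp: U'_def)
  then show "\<exists>U h. open U \<and> x \<in> U \<and> (\<forall>k. Ck_on k U h) \<and> (\<forall>y\<in>S \<inter> U. h y = g (f y))"
    using U W x assms(3) \<open>open U'\<close>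
    by (intro exI[of _ "U'"] exI[of _ "\<lambda>x. g' (f' x)"]) (auto simp: U'_def image_subset_iff)
qed

lemma smooth_on_Pair:
  assumes "smooth_on S f" "smooth_on S g"
  shows "smooth_on S (\<lambda>x. (f x, g x))"
proof -
  have "smooth_on S (\<lambda>x. (f x, 0) + (0, g x))"
    by (intro smooth_on_add smooth_on_linear_comp[OF _ assms(1), of "\<lambda>y. (y, 0)"]
        smooth_on_linear_comp[OF _ assms(2), of "\<lambda>y. (0, y)"] bounded_linear_Pair
        bounded_linear_ident bounded_linear_zero)
  then show ?thesis by simp
qed

section \<open>Gauges on the plane with accumulating symmetries\<close>

text \<open>The linear map from the plane that sends the standard basis to the pair \<open>A\<close>. Pairs of plane
  vectors serve in this way as matrices, given by their columns.\<close>

definition comb :: "'a::real_vector \<times> 'a \<Rightarrow> real \<times> real \<Rightarrow> 'a" where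
  "comb A u = fst u *\<^sub>R fst A + snd u *\<^sub>R snd A"

lemma comb_basis [simp]: "comb A (1, 0) = fst A" "comb A (0, 1) = snd A" "comb A 0 = 0"
  by (simp_all add: comb_def)

lemma linear_comb: "linear (comb A)"
  by (rule linearI) (simp_all add: comb_def algebra_simps)

lemma comb_comb: "comb A (comb M u) = comb (comb A (fst M), comb A (snd M)) u"
  by (simp add: comb_def algebra_simps)

text \<open>If \<open>f\<close> takes the value \<open>f u\<close> along a sequence that approaches \<open>u\<close> from the direction \<open>w0\<close>, then the
  derivative of \<open>f\<close> at \<open>u\<close> in this direction vanishes.\<close>

lemma has_derivative_level_sequence:
  fixes f :: "'a::real_normed_vector \<Rightarrow> real"
  assumes f': "(f has_derivative f') (at u)"
    and r: "r \<longlonglongrightarrow> 0" "\<And>n. r n > (0::real)"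
    and w: "w \<longlonglongrightarrow> w0"
    and level: "\<And>n. f (u + r n *\<^sub>R w n) = f u"
  shows "f' w0 = 0"
proof -
  have bl: "bounded_linear f'"
    using f' has_derivative_bounded_linear by blast
  have lim: "(\<lambda>n. f' (w n)) \<longlonglongrightarrow> f' w0"
    by (rule bounded_linear.tendsto[OF bl w])
  have h0: "(\<lambda>n. r n *\<^sub>R w n) \<longlonglongrightarrow> 0"
    using tendsto_scaleR[OF r(1) w] by simp
  have small: "\<bar>f' w0\<bar> \<le> e * norm w0" if e: "e > 0" for e
  proof -
    obtain d where d: "d > 0"
      "\<And>y. norm (y - u) < d \<Longrightarrow> norm (f y - f u - f' (y - u)) \<le> e * norm (y - u)"
      using f' e unfolding has_derivative_at_alt by blast
    have "\<forall>\<^sub>F n in sequentially. norm (r n *\<^sub>R w n) < d"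
      using h0 d(1) by (auto simp: tendsto_iff dist_norm)
    then have ev: "\<forall>\<^sub>F n in sequentially. \<bar>f' (w n)\<bar> \<le> e * norm (w n)"
    proof eventually_elim
      case (elim n)
      have "norm (f' (r n *\<^sub>R w n)) \<le> e * norm (r n *\<^sub>R w n)"
        using d(2)[of "u + r n *\<^sub>R w n"] elim level[of n] by simp
      then have "r n * \<bar>f' (w n)\<bar> \<le> r n * (e * norm (w n))"
        using r(2)[of n] by (simp add: linear_simps[OF bl] abs_mult mult.left_commute)
      then show ?case
        using r(2)[of n] by simp
    qed
    show ?thesis
      by (rule tendsto_le[OF _ _ _ ev]) (auto intro!: tendsto_intros lim w)
  qed
  show ?thesis
  proof (rule ccontr)
    assume "f' w0 \<noteq> 0"
    then have "norm w0 > 0" "\<bar>f' w0\<bar> > 0"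
      using linear_simps(3)[OF bl] by auto
    then show False
      using small[of "\<bar>f' w0\<bar> / (2 * norm w0)"] by simp
  qed
qed

text \<open>A gauge is a positively homogeneous function that is positive away from the origin. The hypothesis on \<open>B\<close>
  says that \<open>N\<close> is infinitesimally invariant under the linear vector field \<open>u \<mapsto> B u\<close>.\<close>

lemma invariant_gauge_quadratic:
  fixes N :: "real \<times> real \<Rightarrow> real"
  assumes hom: "\<And>t u. t > 0 \<Longrightarrow> N (t *\<^sub>R u) = t * N u"
    and pos: "\<And>u. u \<noteq> 0 \<Longrightarrow> N u > 0"
    and diff: "\<And>u. u \<noteq> 0 \<Longrightarrow> (N has_derivative N' u) (at u)"
    and B: "B \<noteq> 0" "\<And>u. u \<noteq> 0 \<Longrightarrow> N' u (comb B u) = 0"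
  shows "\<exists>\<alpha> \<beta> \<gamma>. \<forall>x y. (N (x, y))\<^sup>2 = \<alpha> * x\<^sup>2 + \<beta> * (x * y) + \<gamma> * y\<^sup>2"
proof -
  obtain a c b d where Beq: "B = ((a, c), (b, d))"
    by (metis prod.exhaust)
  have Bu: "comb B (x, y) = (x * a + y * b, x * c + y * d)" for x y
    by (simp add: Beq comb_def)
  \<comment> \<open>\<open>Q u = det (u, B u)\<close>, whose derivative along \<open>B u\<close> is \<open>tr B \<cdot> Q u\<close> by Cayley--Hamilton\<close>
  define Q where "Q u = c * (fst u)\<^sup>2 + (d - a) * (fst u * snd u) - b * (snd u)\<^sup>2" for u :: "real \<times> real"
  define Q' where "Q' u h = c * (2 * fst u * fst h) + (d - a) * (fst u * snd h + snd u * fst h)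
      - b * (2 * snd u * snd h)" for u h :: "real \<times> real"
  have Qder: "(Q has_derivative Q' u) (at u)" for u
    unfolding Q_def[abs_def] Q'_def[abs_def]
    by (auto intro!: derivative_eq_intros simp: fun_eq_iff algebra_simps)
  have QB: "Q' u (comb B u) = (a + d) * Q u" for u
    by (cases u) (simp add: Bu Q_def Q'_def algebra_simps power2_eq_square)
  have Qu: "Q' u u = 2 * Q u" for u
    by (simp add: Q_def Q'_def algebra_simps power2_eq_square)
  have lin: "linear (N' u)" if "u \<noteq> 0" for u
    using diff[OF that] has_derivative_linear by blast
  have Euler: "N' u u = N u" if u: "u \<noteq> 0" for u
  proof -
    have "((\<lambda>t. N (t *\<^sub>R u)) has_derivative (\<lambda>h. N' u (h *\<^sub>R u))) (at 1)"
    proof (rule has_derivative_compose[where g = N and f = "\<lambda>t. t *\<^sub>R u"])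
      show "((\<lambda>t. t *\<^sub>R u) has_derivative (\<lambda>h. h *\<^sub>R u)) (at 1)"
        by (auto intro!: derivative_eq_intros)
      show "(N has_derivative N' u) (at (1 *\<^sub>R u))"
        using diff[OF u] by simp
    qed
    moreover have "((\<lambda>t. N (t *\<^sub>R u)) has_derivative (\<lambda>h. h * N u)) (at 1)"
      by (rule has_derivative_transform_within_open[of "\<lambda>t. t * N u" _ _ _ "{0<..}"])
        (auto intro!: derivative_eq_intros simp: hom)
    ultimately have "(\<lambda>h. N' u (h *\<^sub>R u)) = (\<lambda>h. h * N u)"
      by (rule has_derivative_unique)
    from fun_cong[OF this, of 1] show ?thesis by simp
  qed
  \<comment> \<open>By Euler's relation, \<open>B\<close> has no real eigenvalue other than \<open>0\<close>.\<close>
  have scaled: "l = 0" if "u \<noteq> 0" "comb B u = l *\<^sub>R u" for u l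
    using B(2)[OF that(1)] linear_scale[OF lin[OF that(1)], of l u] Euler[OF that(1)] pos[OF that(1)]
    by (simp add: that(2))
  \<comment> \<open>A zero \<open>u\<close> of \<open>Q\<close> is an eigenvector, so \<open>B\<close> is nilpotent. Then \<open>N\<close> is constant on a line that does
    not pass through the origin, which contradicts positivity in the direction of the line.\<close>
  have Qnz: "Q u \<noteq> 0" if u: "u \<noteq> 0" for u
  proof
    assume Q0: "Q u = 0"
    obtain x y where uxy: "u = (x, y)" by (cases u)
    have par: "x * (x * c + y * d) = y * (x * a + y * b)"
      using Q0 by (simp add: Q_def uxy algebra_simps power2_eq_square)
    have "\<exists>l. comb B u = l *\<^sub>R u"
    proof (cases "x = 0")
      case True
      then have "y \<noteq> 0" using u uxy by (simp add: zero_prod_def)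
      then have "comb B u = d *\<^sub>R u"
        using par True by (simp add: uxy Bu)
      then show ?thesis ..
    next
      case False
      then have "comb B u = ((x * a + y * b) / x) *\<^sub>R u"
        using par by (simp add: uxy Bu field_simps)
      then show ?thesis ..
    qed
    then have ker: "comb B u = 0"
      using scaled[OF u] by fastforce
    have det: "a * d - b * c = 0"
    proof -
      have "x * a + y * b = 0" "x * c + y * d = 0"
        using ker by (auto simp: uxy Bu zero_prod_def)
      then have "x * (a * d - b * c) = 0" "y * (a * d - b * c) = 0"
        by algebra+
      then show ?thesis
        using u uxy by (auto simp: zero_prod_def)
    qed
    obtain e where e: "comb B e \<noteq> 0"
      using B(1) Bu[of 1 0] Bu[of 0 1] by (metis Beq add_0 add_0_right mult_1 mult_zero_left zero_prod_def)
    \<comment> \<open>\<open>B w = B\<^sup>2 e = tr B \<cdot> B e\<close>, as the determinant vanishes\<close>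
    define w where "w = comb B e"
    have Bw: "comb B w = (a + d) *\<^sub>R w"
    proof (cases e)
      case (Pair s t)
      have "d * a = b * c" using det by algebra
      then show ?thesis
        unfolding w_def Pair by (simp add: Bu) algebra
    qed
    have w: "w \<noteq> 0" using e by (simp add: w_def)
    have Bw0: "comb B w = 0"
      using scaled[OF w Bw] Bw by simp
    have Bt: "comb B (e + t *\<^sub>R w) = w" for t
    proof -
      have "comb B (e + t *\<^sub>R w) = comb B e + t *\<^sub>R comb B w"
        by (simp add: comb_def algebra_simps)
      then show ?thesis by (simp add: Bw0 w_def[symmetric])
    qed
    have nz: "e + t *\<^sub>R w \<noteq> 0" for t
    proof
      assume "e + t *\<^sub>R w = 0"
      then have "comb B 0 = w" using Bt[of t] by simp
      then show False using w by (simp add: comb_def)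
    qed
    have "((\<lambda>t. N (e + t *\<^sub>R w)) has_derivative (\<lambda>h. 0)) (at t within UNIV)" for t
    proof -
      have "((\<lambda>t. N (e + t *\<^sub>R w)) has_derivative (\<lambda>h. N' (e + t *\<^sub>R w) (h *\<^sub>R w))) (at t)"
        by (rule has_derivative_compose[where g = N and f = "\<lambda>t. e + t *\<^sub>R w"])
          (auto intro!: derivative_eq_intros diff nz)
      moreover have "N' (e + t *\<^sub>R w) (h *\<^sub>R w) = 0" for h
        using B(2)[OF nz[of t]] linear_scale[OF lin[OF nz[of t]], of h w] by (simp add: Bt)
      ultimately show ?thesis by simp
    qed
    then obtain k where k: "\<And>t. N (e + t *\<^sub>R w) = k"
      using has_derivative_zero_constant[of UNIV "\<lambda>t. N (e + t *\<^sub>R w)"] by auto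
    have eqn: "N ((1 / real (Suc n)) *\<^sub>R e + w) = k / real (Suc n)" for n
    proof -
      have "(1 / real (Suc n)) *\<^sub>R e + w = (1 / real (Suc n)) *\<^sub>R (e + real (Suc n) *\<^sub>R w)"
        by (simp add: scaleR_add_right del: of_nat_Suc)
      then show ?thesis
        using hom[of "1 / real (Suc n)" "e + real (Suc n) *\<^sub>R w"] k by simp
    qed
    have inv0: "(\<lambda>n. 1 / real (Suc n)) \<longlonglongrightarrow> 0"
      using LIMSEQ_inverse_real_of_nat by (simp add: inverse_eq_divide)
    have "(\<lambda>n. (1 / real (Suc n)) *\<^sub>R e + w) \<longlonglongrightarrow> 0 *\<^sub>R e + w"
      by (intro tendsto_intros inv0)
    then have "(\<lambda>n. N ((1 / real (Suc n)) *\<^sub>R e + w)) \<longlonglongrightarrow> N w"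
      using has_derivative_continuous[OF diff[OF w]] isCont_tendsto_compose[of w N] by simp
    then have "(\<lambda>n. k * (1 / real (Suc n))) \<longlonglongrightarrow> N w"
      by (simp add: eqn del: of_nat_Suc)
    moreover have "(\<lambda>n. k * (1 / real (Suc n))) \<longlonglongrightarrow> k * 0"
      by (intro tendsto_intros inv0)
    ultimately have "N w = k * 0"
      by (rule LIMSEQ_unique)
    then have "N w = 0" by simp
    then show False using pos[OF w] by simp
  qed
  \<comment> \<open>\<open>N\<^sup>2 / Q\<close> is homogeneous of degree \<open>0\<close>. At a maximum its derivative \<open>- tr B \<cdot> f\<close> along \<open>B u\<close> vanishes,
    so \<open>tr B = 0\<close>. Then \<open>f\<close> is invariant in the directions \<open>u\<close> and \<open>B u\<close>, which span the plane.\<close>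
  define f where "f u = (N u)\<^sup>2 / Q u" for u
  define f' where "f' u h = (2 * N u * N' u h * Q u - (N u)\<^sup>2 * Q' u h) / (Q u)\<^sup>2" for u h
  have fder: "(f has_derivative f' u) (at u)" if u: "u \<noteq> 0" for u
    unfolding f_def[abs_def] f'_def[abs_def]
    using Qnz[OF u]
    by (auto intro!: derivative_eq_intros diff[OF u] Qder simp: fun_eq_iff field_simps power2_eq_square)
  have fB: "f' u (comb B u) = - (a + d) * f u" if u: "u \<noteq> 0" for u
    using Qnz[OF u] by (simp add: f'_def f_def B(2)[OF u] QB power2_eq_square field_simps)
  have fu: "f' u u = 0" if u: "u \<noteq> 0" for u
    by (simp add: f'_def Euler[OF u] Qu power2_eq_square)
  have fhom: "f (t *\<^sub>R u) = f u" if "t > 0" for t u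
  proof -
    have "Q (t *\<^sub>R u) = t\<^sup>2 * Q u"
      by (simp add: Q_def algebra_simps power2_eq_square)
    then show ?thesis
      using that by (simp add: f_def hom power_mult_distrib)
  qed
  have tr: "a + d = 0"
  proof -
    have "continuous_on (sphere 0 1) f"
      by (intro continuous_at_imp_continuous_on ballI has_derivative_continuous[OF fder]) auto
    moreover have "sphere (0 :: real \<times> real) 1 \<noteq> {}"
      by simp
    ultimately obtain u0 where u0: "u0 \<in> sphere 0 1" "\<And>u. u \<in> sphere 0 1 \<Longrightarrow> f u \<le> f u0"
      using continuous_attains_sup[of "sphere (0 :: real \<times> real) 1" f] by auto
    have nz: "u0 \<noteq> 0" using u0(1) by auto
    have max: "f u \<le> f u0" if "u \<in> - {0}" for u
      using u0(2)[of "(1 / norm u) *\<^sub>R u"] fhom[of "1 / norm u" u] that by simp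
    have "f' u0 = (\<lambda>h. 0)"
      by (rule differential_zero_maxmin[of u0 "- {0}" f]) (use nz fder max in auto)
    then have "- (a + d) * f u0 = 0"
      using fB[OF nz] by simp
    moreover have "f u0 \<noteq> 0"
      using pos[OF nz] Qnz[OF nz] by (simp add: f_def)
    ultimately show ?thesis by simp
  qed
  have f0: "f' u h = 0" if u: "u \<noteq> 0" for u h
  proof -
    obtain x y where uxy: "u = (x, y)" by (cases u)
    obtain p q where hpq: "h = (p, q)" by (cases h)
    define s where "s = (p * (x * c + y * d) - q * (x * a + y * b)) / Q u"
    define t where "t = (x * q - y * p) / Q u"
    have "Q u *\<^sub>R h = (s * Q u) *\<^sub>R u + (t * Q u) *\<^sub>R comb B u"
      using Qnz[OF u] by (simp add: s_def t_def uxy hpq Bu) (simp add: Q_def algebra_simps power2_eq_square)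
    then have "Q u *\<^sub>R h = Q u *\<^sub>R (s *\<^sub>R u + t *\<^sub>R comb B u)"
      by (simp add: algebra_simps)
    then have "h = s *\<^sub>R u + t *\<^sub>R comb B u"
      using Qnz[OF u] by (simp only: scaleR_cancel_left) simp
    moreover have "linear (f' u)"
      using fder[OF u] has_derivative_linear by blast
    ultimately have "f' u h = s * f' u u + t * f' u (comb B u)"
      by (simp add: linear_add linear_scale)
    then show ?thesis using fu[OF u] fB[OF u] tr by simp
  qed
  have conn: "connected (- {0 :: real \<times> real})"
    by (intro connected_punctured_universe) simp
  have const: "f u = f (1, 0)" if "u \<noteq> 0" for u
  proof (rule has_derivative_zero_unique_connected[OF _ conn, of f])
    show "(f has_derivative (\<lambda>h. 0)) (at v)" if "v \<in> - {0}" for v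
    proof -
      have "v \<noteq> 0" using that by simp
      moreover from f0[OF this] have "f' v = (\<lambda>h. 0)" by auto
      ultimately show ?thesis using fder[of v] by simp
    qed
  qed (use that in \<open>auto simp: zero_prod_def\<close>)
  have *: "(N u)\<^sup>2 = f (1, 0) * Q u" if "u \<noteq> 0" for u
  proof -
    have "(N u)\<^sup>2 = f u * Q u"
      using Qnz[OF that] by (simp add: f_def)
    then show ?thesis using const[OF that] by simp
  qed
  have N0: "N 0 = 0"
    using hom[of 2 0] by simp
  have "(N (x, y))\<^sup>2 = f (1, 0) * Q (x, y)" for x y
    using *[of "(x, y)"] N0 by (cases "(x, y) = 0") (auto simp: Q_def zero_prod_def)
  then have "(N (x, y))\<^sup>2 = (f (1, 0) * c) * x\<^sup>2 + (f (1, 0) * (d - a)) * (x * y) + (- f (1, 0) * b) * y\<^sup>2"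
    for x y
    unfolding \<open>(N (x, y))\<^sup>2 = f (1, 0) * Q (x, y)\<close> by (simp add: Q_def algebra_simps)
  then show ?thesis by blast
qed

text \<open>The infinitesimal symmetry is a limit point of the normalised differences \<open>(M\<^sub>n - 1) / \<bar>M\<^sub>n - 1\<bar>\<close>.\<close>

lemma gauge_quadratic_if_symmetries_accumulate:
  fixes N :: "real \<times> real \<Rightarrow> real"
  assumes hom: "\<And>t u. t > 0 \<Longrightarrow> N (t *\<^sub>R u) = t * N u"
    and pos: "\<And>u. u \<noteq> 0 \<Longrightarrow> N u > 0"
    and diff: "\<And>u. u \<noteq> 0 \<Longrightarrow> N differentiable (at u)"
    and M: "\<And>n u. N (comb (M n) u) = N u" "\<And>n. M n \<noteq> ((1, 0), (0, 1))"
      "M \<longlonglongrightarrow> ((1, 0), (0, 1))"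
  shows "\<exists>\<alpha> \<beta> \<gamma>. \<forall>x y. (N (x, y))\<^sup>2 = \<alpha> * x\<^sup>2 + \<beta> * (x * y) + \<gamma> * y\<^sup>2"
proof -
  define I :: "(real \<times> real) \<times> (real \<times> real)" where "I = ((1, 0), (0, 1))"
  define r where "r n = norm (M n - I)" for n
  define C where "C n = (1 / r n) *\<^sub>R (M n - I)" for n
  have r: "r n > 0" for n
    using M(2)[of n] by (simp add: r_def I_def)
  have "C n \<in> sphere 0 1" for n
    using r[of n] by (simp add: C_def r_def)
  then obtain B s where s: "B \<in> sphere 0 1" "strict_mono s" "(C \<circ> s) \<longlonglongrightarrow> B"
    using compact_sphere[of "0 :: (real \<times> real) \<times> (real \<times> real)" 1] unfolding compact_def by metis
  have "(\<lambda>n. norm (M n - I)) \<longlonglongrightarrow> norm (I - I)"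
    by (intro tendsto_intros) (use M(3) in \<open>simp add: I_def\<close>)
  then have r0: "(r \<circ> s) \<longlonglongrightarrow> 0"
    using LIMSEQ_subseq_LIMSEQ[OF _ s(2)] by (simp add: r_def[abs_def])
  obtain N' where N': "\<And>u. u \<noteq> 0 \<Longrightarrow> (N has_derivative N' u) (at u)"
    using diff unfolding differentiable_def by metis
  have "N' u (comb B u) = 0" if u: "u \<noteq> 0" for u
  proof (rule has_derivative_level_sequence[OF N'[OF u] r0])
    show "(\<lambda>n. comb ((C \<circ> s) n) u) \<longlonglongrightarrow> comb B u"
      unfolding comb_def by (intro tendsto_intros s(3))
    show "N (u + (r \<circ> s) n *\<^sub>R comb ((C \<circ> s) n) u) = N u" for n
    proof -
      have "u + r m *\<^sub>R comb (C m) u = comb (M m) u" for m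
      proof -
        have "M m = I + r m *\<^sub>R C m"
          using r[of m] by (simp add: C_def)
        then have "comb (M m) u = comb I u + r m *\<^sub>R comb (C m) u"
          by (simp add: comb_def algebra_simps)
        moreover have "comb I u = u"
          by (cases u) (simp add: comb_def I_def)
        ultimately show ?thesis by simp
      qed
      then show ?thesis by (simp add: M(1))
    qed
  qed (use r in auto)
  moreover have "B \<noteq> 0" using s(1) by auto
  ultimately show ?thesis
    using invariant_gauge_quadratic[of N N' B] hom pos N' by blast
qed

section \<open>The hairy ball theorem\<close>

text \<open>On the unit circle, the square map has winding number \<open>2\<close>.\<close>

lemma circle_square_no_log:
  fixes k :: "complex \<Rightarrow> complex"
  assumes k: "continuous_on (sphere 0 1) k"
  shows "\<exists>z\<in>sphere 0 1. z\<^sup>2 \<noteq> exp (k z)"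
proof (rule ccontr)
  assume "\<not> ?thesis"
  then have ek: "exp (k z) = z\<^sup>2" if "norm z = 1" for z
    using that by auto
  define h where "h t = k (cis t) - of_real (2 * t) * \<i>" for t :: real
  have cont: "continuous_on UNIV h"
    unfolding h_def
    by (intro continuous_intros continuous_on_compose2[OF k]) auto
  have one: "exp (h t) = 1" for t
  proof -
    have "exp (of_real (2 * t) * \<i>) = cis t ^ 2"
      using exp_double[of "\<i> * of_real t"] by (simp add: cis_conv_exp mult_ac)
    then show ?thesis
      by (simp add: h_def exp_diff ek)
  qed
  have "h constant_on UNIV"
  proof (rule continuous_discrete_range_constant[OF _ cont])
    show "\<exists>e>0. \<forall>y. y \<in> UNIV \<and> h y \<noteq> h x \<longrightarrow> e \<le> norm (h y - h x)" if "x \<in> UNIV" for x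
    proof (intro exI[of _ "2 * pi"] conjI allI impI)
      fix y assume "y \<in> UNIV \<and> h y \<noteq> h x"
      moreover have "exp (h y) = exp (h x)" by (simp add: one)
      then obtain n :: int where n: "h y = h x + (of_int (2 * n) * pi) * \<i>"
        using exp_eq by blast
      ultimately have "n \<noteq> 0" by auto
      then have "\<bar>real_of_int n\<bar> \<ge> 1" by linarith
      then show "2 * pi \<le> norm (h y - h x)"
        using n by (simp add: norm_mult)
    qed auto
  qed auto
  then have "h 0 = h (2 * pi)"
    by (auto simp: constant_on_def)
  then show False
    by (simp add: h_def cis_2pi complex_eq_iff)
qed

text \<open>Over the closed hemisphere around a pole \<open>s = \<plusminus> 1\<close> on the third axis, parallel transport of the
  round metric to the pole along meridians turns the field into a function \<open>f s\<close> from the disc to the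
  punctured plane, which has a continuous logarithm. On the equator the two functions differ by complex
  conjugation and the factor \<open>- z\<^sup>2\<close>, so \<open>z\<^sup>2\<close> would have a continuous logarithm as well.\<close>

lemma hairy_ball:
  fixes X :: "real^3 \<Rightarrow> real^3"
  assumes X: "continuous_on S2 X" and tan: "\<And>p. p \<in> S2 \<Longrightarrow> X p \<in> tangent p"
  shows "\<exists>p\<in>S2. X p = 0"
proof (rule ccontr)
  assume "\<not> ?thesis"
  then have nz: "X p \<noteq> 0" if "p \<in> S2" for p
    using that by blast
  define P where "P s z = (vector [Re z, Im z, s * sqrt (1 - (norm z)\<^sup>2)] :: real^3)" for s :: real and z
  define f where "f s z = Complex (X (P s z) $ 1 - X (P s z) $ 3 / (s + P s z $ 3) * P s z $ 1)
    (X (P s z) $ 2 - X (P s z) $ 3 / (s + P s z $ 3) * P s z $ 2)" for s :: real and z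
  have P_nth: "P s z $ 1 = Re z" "P s z $ 2 = Im z" "P s z $ 3 = s * sqrt (1 - (norm z)\<^sup>2)" for s z
    by (simp_all add: P_def)
  have P_S2: "P s z \<in> S2" if "s\<^sup>2 = 1" "norm z \<le> 1" for s z
  proof -
    have "(norm z)\<^sup>2 \<le> 1" using that(2) by (simp add: power_le_one)
    then have "(norm (P s z))\<^sup>2 = 1"
      using that(1)
      by (subst power2_norm_eq_inner)
        (simp add: inner_vec_def sum_3 P_nth power_mult_distrib cmod_power2 flip: power2_eq_square)
    then show ?thesis using norm_ge_zero[of "P s z"] by (auto simp: power2_eq_1_iff simp del: norm_ge_zero)
  qed
  have P_cont: "continuous_on (cball 0 1) (P s)" for s
  proof -
    have "continuous_on (cball 0 1) ((\<lambda>z. \<chi> i. if i = 1 then Re z else if i = 2 then Im z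
      else s * sqrt (1 - (norm z)\<^sup>2)) :: complex \<Rightarrow> real^3)"
    proof (rule continuous_on_vec_lambda)
      fix i :: 3
      consider "i = 1" | "i = 2" | "i = 3" using exhaust_3 by blast
      then show "continuous_on (cball 0 1)
          (\<lambda>z. if i = 1 then Re z else if i = 2 then Im z else s * sqrt (1 - (norm z)\<^sup>2))"
        by cases (auto intro!: continuous_intros)
    qed
    moreover have "P s = (\<lambda>z. \<chi> i::3. if i = 1 then Re z else if i = 2 then Im z
      else s * sqrt (1 - (norm z)\<^sup>2))"
      by (auto simp: fun_eq_iff vec_eq_iff forall_3 P_nth)
    ultimately show ?thesis by simp
  qed
  have den: "s + P s z $ 3 \<noteq> 0" if "s = 1 \<or> s = -1" "norm z \<le> 1" for s z
  proof -
    have "(norm z)\<^sup>2 \<le> 1" using that(2) by (simp add: power_le_one)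
    then have "sqrt (1 - (norm z)\<^sup>2) \<ge> 0" by simp
    then have "1 + sqrt (1 - (norm z)\<^sup>2) \<noteq> 0" "- 1 - sqrt (1 - (norm z)\<^sup>2) \<noteq> 0" by linarith+
    then show ?thesis using that(1) by (elim disjE) (simp_all add: P_nth)
  qed
  have tan3: "x * X p $ 1 + y * X p $ 2 + w * X p $ 3 = 0"
    if "p \<in> S2" "p $ 1 = x" "p $ 2 = y" "p $ 3 = w" for p x y w
    using tan[OF that(1)] that by (simp add: tangent_def inner_vec_def sum_3)
  have S2_3: "x\<^sup>2 + y\<^sup>2 + w\<^sup>2 = 1"
    if "p \<in> S2" "p $ 1 = x" "p $ 2 = y" "p $ 3 = w" for p x y w
    using that by (simp add: norm_eq_1 inner_vec_def sum_3 power2_eq_square)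
  have f_cont: "continuous_on (cball 0 1) (f s)" if s: "s = 1 \<or> s = -1" for s
  proof -
    have XP: "continuous_on (cball 0 1) (\<lambda>z. X (P s z))"
      using s P_S2 by (intro continuous_on_compose2[OF X P_cont]) auto
    show ?thesis
      unfolding f_def
      by (intro continuous_intros XP P_cont) (use den[OF s] in auto)
  qed
  have f_nz: "f s z \<noteq> 0" if s: "s = 1 \<or> s = -1" and z: "norm z \<le> 1" for s z
  proof
    assume f0: "f s z = 0"
    define p where "p = P s z"
    define v where "v = X p"
    define l where "l = v $ 3 / (s + p $ 3)"
    have p: "p \<in> S2" using s P_S2[OF _ z] by (auto simp: p_def)
    have d: "s + p $ 3 \<noteq> 0" using den[OF s z] by (simp add: p_def)
    have v1: "v $ 1 = l * p $ 1" and v2: "v $ 2 = l * p $ 2"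
      using f0 by (simp_all add: f_def complex_eq_iff l_def v_def p_def)
    have v3: "v $ 3 = l * (s + p $ 3)"
      using d by (simp add: l_def)
    have "p $ 1 * (l * p $ 1) + p $ 2 * (l * p $ 2) + p $ 3 * (l * (s + p $ 3)) = 0"
      using tan3[OF p refl refl refl] by (simp add: v1 v2 v3 flip: v_def)
    moreover have "(p $ 1)\<^sup>2 + (p $ 2)\<^sup>2 + (p $ 3)\<^sup>2 = 1"
      by (rule S2_3[OF p refl refl refl])
    ultimately have "l * (1 + s * p $ 3) = 0" by algebra
    moreover have "1 + s * p $ 3 = s * (s + p $ 3)" using s by (auto simp: algebra_simps)
    ultimately have "l = 0" using d s by auto
    then have "v = 0"
      using v1 v2 v3 by (simp add: vec_eq_iff forall_3)
    then show False using nz[OF p] by (simp add: v_def)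
  qed
  have "\<exists>h. continuous_on (cball 0 1) h \<and> (\<forall>z\<in>cball 0 1. f s z = exp (h z))"
    if s: "s = 1 \<or> s = -1" for s
    using continuous_logarithm_on_cball[OF f_cont[OF s]] f_nz[OF s] by (metis mem_cball_0)
  then obtain h1 h2 where h1: "continuous_on (cball 0 1) h1" "\<forall>z\<in>cball 0 1. f 1 z = exp (h1 z)"
    and h2: "continuous_on (cball 0 1) h2" "\<forall>z\<in>cball 0 1. f (-1) z = exp (h2 z)"
    by metis
  have rel: "f (-1) z = - cnj (f 1 z) * z\<^sup>2" if z: "norm z = 1" for z
  proof -
    define x y where "x = Re z" and "y = Im z"
    define p :: "real^3" where "p = vector [x, y, 0]"
    have Pz: "P s z = p" for s
      using z by (simp add: P_def p_def x_def y_def)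
    define u v w where "u = X p $ 1" and "v = X p $ 2" and "w = X p $ 3"
    have p: "p \<in> S2" using P_S2[of 1 z] z by (simp add: Pz)
    have 1: "x * u + y * v = 0"
      using tan3[OF p refl refl refl] by (simp add: p_def flip: u_def v_def w_def) (simp add: u_def v_def p_def)
    have 2: "x\<^sup>2 + y\<^sup>2 = 1"
      using S2_3[OF p refl refl refl] by (simp add: p_def)
    have f1: "f 1 z = Complex (u - w * x) (v - w * y)"
      unfolding f_def Pz u_def v_def w_def by (simp add: p_def)
    have f2: "f (-1) z = Complex (u + w * x) (v + w * y)"
      unfolding f_def Pz u_def v_def w_def by (simp add: p_def)
    have zz: "z = Complex x y" by (simp add: x_def y_def)
    have A: "u + w * x = - (u - w * x) * (x\<^sup>2 - y\<^sup>2) - (v - w * y) * (2 * x * y)"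
      using 1 2 by algebra
    have B: "v + w * y = (v - w * y) * (x\<^sup>2 - y\<^sup>2) - (u - w * x) * (2 * x * y)"
      using 1 2 by algebra
    show ?thesis
      unfolding f1 f2 using A B
      by (simp add: zz complex_eq_iff power2_eq_square algebra_simps)
  qed
  define k where "k z = \<i> * pi + h2 z - cnj (h1 z)" for z
  have "continuous_on (sphere 0 1) k"
    unfolding k_def
    by (intro continuous_intros continuous_on_subset[OF h1(1)] continuous_on_subset[OF h2(1)]) auto
  moreover have "z\<^sup>2 = exp (k z)" if z: "z \<in> sphere 0 1" for z
  proof -
    have e: "exp (h2 z) = - exp (cnj (h1 z)) * z\<^sup>2"
      using rel[of z] h1(2) h2(2) z by (simp add: exp_cnj)
    have "exp (k z) = exp (\<i> * pi) * exp (h2 z) / exp (cnj (h1 z))"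
      by (simp add: k_def exp_diff exp_add)
    also have "\<dots> = z\<^sup>2"
      unfolding e by (simp add: exp_pi_i' )
    finally show ?thesis by simp
  qed
  ultimately show False
    using circle_square_no_log by blast
qed

section \<open>Maps with separated fibres as coverings\<close>

text \<open>The sheets over a small neighbourhood of \<open>b\<close> are the traces of the balls of radius \<open>d / 2\<close> around the points of
  the fibre over \<open>b\<close>.\<close>

lemma covering_space_separated_fibres:
  fixes p :: "'a::metric_space \<Rightarrow> 'b::metric_space"
  assumes cont: "continuous_on E p" and onto: "p ` E = S"
    and d: "d > 0" "\<And>x y. x \<in> E \<Longrightarrow> y \<in> E \<Longrightarrow> p x = p y \<Longrightarrow> dist x y < d \<Longrightarrow> x = y"
    and lift: "\<And>e. e > 0 \<Longrightarrow> \<exists>r>0. \<forall>x\<in>E. \<forall>b\<in>S. dist b (p x) < r \<longrightarrow> (\<exists>y\<in>E. p y = b \<and> dist y x < e)"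
  shows "covering_space E p S"
proof
  show "continuous_on E p" "p ` E = S" by fact+
next
  fix b assume b: "b \<in> S"
  obtain r where r: "r > 0"
    "\<And>x c. x \<in> E \<Longrightarrow> c \<in> S \<Longrightarrow> dist c (p x) < r \<Longrightarrow> \<exists>y\<in>E. p y = c \<and> dist y x < d / 2"
    using lift[of "d / 2"] d(1) by (auto simp: Bex_def)
  define T where "T = S \<inter> ball b r"
  define sheet where "sheet x = (E \<inter> p -` T) \<inter> ball x (d / 2)" for x
  have T_open: "openin (top_of_set S) T"
    unfolding T_def by (simp add: openin_open_Int)
  have pre_open: "openin (top_of_set E) (E \<inter> p -` T)"
    using continuous_on_open[of E p] cont onto T_open by simp
  have sheet_open: "openin (top_of_set E) (sheet x)" for x
    unfolding sheet_def using openin_Int_open[OF pre_open] by blast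
  have uniq: "y = z" if "y \<in> sheet x" "z \<in> sheet x" "p y = p z" for x y z
  proof -
    have "dist y z \<le> dist x y + dist x z"
      by (rule dist_triangle3)
    then have "dist y z < d" using that(1,2) unfolding sheet_def by auto
    then show ?thesis using d(2)[of y z] that unfolding sheet_def by auto
  qed
  have homeo: "\<exists>q. homeomorphism (sheet x) T p q" if x: "x \<in> E" "p x = b" for x
  proof -
    have "\<exists>y\<in>sheet x. p y = c" if "c \<in> T" for c
    proof -
      have "c \<in> S" "dist c (p x) < r"
        using that x by (auto simp: T_def dist_commute)
      then show ?thesis
        using r(2)[of x c] x that by (auto simp: sheet_def dist_commute)
    qed
    then obtain q where q: "\<And>c. c \<in> T \<Longrightarrow> q c \<in> sheet x" "\<And>c. c \<in> T \<Longrightarrow> p (q c) = c"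
      by metis
    have "continuous_on T q"
      unfolding continuous_on_iff
    proof (intro ballI allI impI)
      fix c and e :: real assume c: "c \<in> T" and e: "e > 0"
      define e' where "e' = min e (d / 2 - dist x (q c))"
      have "e' > 0" using e q(1)[OF c] by (simp add: e'_def sheet_def)
      then obtain s where s: "s > 0"
        "\<And>y a. y \<in> E \<Longrightarrow> a \<in> S \<Longrightarrow> dist a (p y) < s \<Longrightarrow> \<exists>z\<in>E. p z = a \<and> dist z y < e'"
        using lift[of e'] by (auto simp: Bex_def)
      show "\<exists>s>0. \<forall>a\<in>T. dist a c < s \<longrightarrow> dist (q a) (q c) < e"
      proof (intro exI[of _ s] conjI ballI impI s(1))
        fix a assume a: "a \<in> T" "dist a c < s"
        have "q c \<in> E" using q(1)[OF c] by (simp add: sheet_def)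
        then obtain z where z: "z \<in> E" "p z = a" "dist z (q c) < e'"
          using s(2)[of "q c" a] a q(2)[OF c] by (auto simp: T_def)
        have "dist x z \<le> dist x (q c) + dist z (q c)"
          by (rule dist_triangle2)
        then have "z \<in> sheet x"
          using z a by (simp add: sheet_def e'_def)
        then have "z = q a"
          using uniq[of z x "q a"] q a z by auto
        then show "dist (q a) (q c) < e" using z by (simp add: e'_def)
      qed
    qed
    then have "homeomorphism (sheet x) T p q"
      unfolding homeomorphism_def
    proof (intro conjI)
      show "\<forall>y\<in>sheet x. q (p y) = y"
        using uniq q by (metis IntD1 IntD2 sheet_def vimageE)
      show "continuous_on (sheet x) p"
        using cont continuous_on_subset by (metis inf.cobounded1 le_infI1 sheet_def)
      show "p ` sheet x = T"
        using q by (force simp: sheet_def)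
      then show "q ` T = sheet x"
        using q \<open>\<forall>y\<in>sheet x. q (p y) = y\<close> by force
    qed (use q in auto)
    then show ?thesis by blast
  qed
  show "\<exists>T. b \<in> T \<and> openin (top_of_set S) T \<and>
      (\<exists>v. \<Union> v = E \<inter> p -` T \<and> (\<forall>u\<in>v. openin (top_of_set E) u) \<and> pairwise disjnt v \<and>
        (\<forall>u\<in>v. \<exists>q. homeomorphism u T p q))"
  proof (intro exI[of _ T] conjI exI[of _ "sheet ` {x \<in> E. p x = b}"])
    show "b \<in> T" using b r(1) by (simp add: T_def)
    show "\<Union> (sheet ` {x \<in> E. p x = b}) = E \<inter> p -` T"
    proof
      show "E \<inter> p -` T \<subseteq> \<Union> (sheet ` {x \<in> E. p x = b})"
      proof
        fix y assume y: "y \<in> E \<inter> p -` T"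
        then obtain x where "x \<in> E" "p x = b" "dist x y < d / 2"
          using r(2)[of y b] b by (auto simp: T_def)
        then show "y \<in> \<Union> (sheet ` {x \<in> E. p x = b})"
          using y by (auto simp: sheet_def)
      qed
    qed (auto simp: sheet_def)
    show "pairwise disjnt (sheet ` {x \<in> E. p x = b})"
    proof (rule pairwiseI, clarsimp)
      fix x y assume xy: "x \<in> E" "y \<in> E" "p y = p x" "b = p x" "sheet x \<noteq> sheet y"
      show "disjnt (sheet x) (sheet y)"
      proof (rule ccontr)
        assume "\<not> ?thesis"
        then obtain z where z: "dist x z < d / 2" "dist y z < d / 2"
          by (auto simp: disjnt_def sheet_def)
        have "dist x y < d"
          using dist_triangle2[of x y z] z by linarith
        then show False using d(2)[of x y] xy by auto
      qed
    qed
  qed (use T_open sheet_open homeo in auto)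
qed

section \<open>Finsler metrics\<close>

lemma tangent_nontrivial:
  obtains e where "e \<in> tangent p" "norm e = 1"
proof -
  obtain y :: "real^3" where y: "y \<noteq> 0" "orthogonal p y"
    using orthogonal_to_vector_exists[of p] by auto
  show ?thesis
    by (rule that[of "(1 / norm y) *\<^sub>R y"])
      (use y in \<open>auto simp: tangent_def orthogonal_def\<close>)
qed

lemma tangent_subspace: "subspace (tangent p)"
  by (auto simp: subspace_def tangent_def inner_add_right)

lemma finsler_hom:
  assumes "finsler_metric F" "p \<in> S2" "v \<in> tangent p" "t > 0"
  shows "F (p, t *\<^sub>R v) = t * F (p, v)"
  using assms unfolding finsler_metric_def TS2_def by blast

lemma finsler_zero:
  assumes "finsler_metric F" "p \<in> S2"
  shows "F (p, 0) = 0"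
  using finsler_hom[OF assms, of 0 2] by (simp add: tangent_def)

text \<open>On a ray where \<open>F\<close> vanishes, the fibre Hessian would vanish in the radial direction.\<close>

lemma finsler_pos:
  assumes F: "finsler_metric F" and p: "p \<in> S2" and v: "v \<in> tangent p" "v \<noteq> 0"
  shows "F (p, v) > 0"
proof (rule ccontr)
  assume "\<not> ?thesis"
  moreover have "F (p, v) \<ge> 0"
    using F p v unfolding finsler_metric_def TS2_def by blast
  ultimately have F0: "F (p, v) = 0" by simp
  have ray: "F (p, v + s *\<^sub>R v + t *\<^sub>R v) = 0" if "1 + s + t > 0" for s t
  proof -
    have "v + s *\<^sub>R v + t *\<^sub>R v = (1 + s + t) *\<^sub>R v"
      by (simp add: scaleR_left_distrib)
    then show ?thesis
      using finsler_hom[OF F p v(1) that] F0 by simp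
  qed
  have inner: "deriv (\<lambda>t. (F (p, v + s *\<^sub>R v + t *\<^sub>R v))\<^sup>2 / 2) 0 = 0" if s: "s > -1" for s
  proof (rule DERIV_imp_deriv, rule has_field_derivative_transform_within_open[of "\<lambda>t. 0"])
    show "0 = (F (p, v + s *\<^sub>R v + t *\<^sub>R v))\<^sup>2 / 2" if "t \<in> {-1 - s<..}" for t
      using ray[of s t] that by simp
  qed (use s in auto)
  have "fibre_hessian F p v v v = 0"
    unfolding fibre_hessian_def
  proof (rule DERIV_imp_deriv, rule has_field_derivative_transform_within_open[of "\<lambda>t. 0"])
    show "0 = deriv (\<lambda>t. (F (p, v + s *\<^sub>R v + t *\<^sub>R v))\<^sup>2 / 2) 0" if "s \<in> {-1<..}" for s
      using inner[of s] that by simp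
  qed auto
  moreover have "fibre_hessian F p v v v > 0"
    using F p v unfolding finsler_metric_def slit_TS2_def by blast
  ultimately show False by simp
qed

lemma closed_TS2: "closed TS2"
proof -
  have eq: "TS2 = (S2 \<times> UNIV) \<inter> {z. fst z \<bullet> snd z = 0}"
    by (auto simp: TS2_def tangent_def)
  show ?thesis
    unfolding eq
    by (intro closed_Int closed_Times closed_sphere closed_UNIV closed_Collect_eq continuous_intros)
qed

lemma finsler_bounds:
  assumes F: "finsler_metric F"
  obtains c C where "c > 0" "C > 0"
    "\<And>p v. p \<in> S2 \<Longrightarrow> v \<in> tangent p \<Longrightarrow> c * norm v \<le> F (p, v) \<and> F (p, v) \<le> C * norm v"
proof -
  define U where "U = TS2 \<inter> (cball 0 1 \<times> sphere 0 1)"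
  have U: "compact U"
    unfolding U_def by (intro closed_Int_compact closed_TS2 compact_Times) auto
  obtain e where e: "e \<in> tangent (axis 1 1)" "norm e = 1"
    by (rule tangent_nontrivial)
  then have "(axis 1 1, e) \<in> U"
    by (simp add: U_def TS2_def)
  then have ne: "U \<noteq> {}" by blast
  have cont: "continuous_on U F"
    using F unfolding finsler_metric_def U_def by (blast intro: continuous_on_subset)
  obtain z1 where z1: "z1 \<in> U" "\<And>z. z \<in> U \<Longrightarrow> F z1 \<le> F z"
    using continuous_attains_inf[OF U ne cont] by blast
  obtain z2 where z2: "z2 \<in> U" "\<And>z. z \<in> U \<Longrightarrow> F z \<le> F z2"
    using continuous_attains_sup[OF U ne cont] by blast
  have pos: "F z > 0" if z: "z \<in> U" for z
    using finsler_pos[OF F, of "fst z" "snd z"] z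
    by (cases "snd z = 0") (auto simp: U_def TS2_def)
  show ?thesis
  proof (rule that[OF pos[OF z1(1)] pos[OF z2(1)]])
    fix p v assume p: "p \<in> S2" and v: "v \<in> tangent p"
    show "F z1 * norm v \<le> F (p, v) \<and> F (p, v) \<le> F z2 * norm v"
    proof (cases "v = 0")
      case True
      then show ?thesis using finsler_zero[OF F p] by simp
    next
      case False
      define w where "w = (1 / norm v) *\<^sub>R v"
      have w: "w \<in> tangent p" unfolding w_def by (rule subspace_scale[OF tangent_subspace v])
      have "(p, w) \<in> U"
        using p w False by (auto simp: U_def TS2_def w_def)
      moreover have "F (p, v) = norm v * F (p, w)"
        using finsler_hom[OF F p w, of "norm v"] False by (simp add: w_def)
      ultimately show ?thesis
        using mult_left_mono[OF z1(2)[of "(p, w)"] norm_ge_zero[of v]]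
          mult_left_mono[OF z2(2)[of "(p, w)"] norm_ge_zero[of v]] by (simp add: mult.commute)
    qed
  qed
qed

lemma comb_in_tangent: "fst A \<in> tangent p \<Longrightarrow> snd A \<in> tangent p \<Longrightarrow> comb A u \<in> tangent p"
  unfolding comb_def by (intro subspace_add subspace_scale tangent_subspace)

lemma tangent_subset_range_comb:
  assumes p: "p \<in> S2" and A: "fst A \<in> tangent p" "snd A \<in> tangent p"
    and inj: "\<And>u. comb A u = 0 \<Longrightarrow> u = 0"
  shows "tangent p \<subseteq> range (comb A)"
proof -
  have "inj (comb A)"
    using inj by (simp add: linear_injective_0[OF linear_comb])
  then have "dim (range (comb A)) = 2"
    using dim_image_eq[OF linear_comb, of A UNIV] by simp
  moreover have "dim (tangent p) = 2"
  proof -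
    have "p \<noteq> 0" using p by auto
    then show ?thesis unfolding tangent_def using dim_hyperplane[of p] by simp
  qed
  ultimately have "range (comb A) = tangent p"
    using A by (intro subspace_dim_equal tangent_subspace linear_subspace_image linear_comb)
      (auto intro: comb_in_tangent)
  then show ?thesis by simp
qed

lemma finsler_differentiable:
  assumes F: "finsler_metric F" and p: "p \<in> S2" and A: "fst A \<in> tangent p" "snd A \<in> tangent p"
    and inj: "\<And>u. comb A u = 0 \<Longrightarrow> u = 0" and u: "u \<noteq> 0"
  shows "(\<lambda>u. F (p, comb A u)) differentiable (at u)"
proof -
  have "smooth_on (- {0}) (\<lambda>u. F (p, comb A u))"
  proof (rule smooth_on_compose[where f = "\<lambda>u. (p, comb A u)" and g = F])
    show "smooth_on (- {0}) (\<lambda>u. (p, comb A u))"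
      unfolding comb_def
      by (intro smooth_on_Pair smooth_on_add smooth_on_scaleR smooth_on_const
          smooth_on_bounded_linear bounded_linear_fst bounded_linear_snd)
    show "smooth_on slit_TS2 F"
      using F by (simp add: finsler_metric_def)
    show "(\<lambda>u. (p, comb A u)) ` (- {0}) \<subseteq> slit_TS2"
      using p inj comb_in_tangent[OF A] by (auto simp: slit_TS2_def)
  qed
  then have "\<forall>k. Ck_on k (- {0}) (\<lambda>u. F (p, comb A u))"
    by (subst (asm) smooth_on_open_iff) (auto simp: open_Compl)
  then have "Ck_on (Suc 0) (- {0}) (\<lambda>u. F (p, comb A u))" ..
  then show ?thesis using u by simp
qed

section \<open>Finsler metrics that are quadratic on the fibres\<close>

lemma smooth_on_finsler_field:
  assumes F: "finsler_metric F" and S: "S \<subseteq> S2" and Y: "smooth_on S Y"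
    "\<And>p. p \<in> S \<Longrightarrow> Y p \<in> tangent p" "\<And>p. p \<in> S \<Longrightarrow> Y p \<noteq> 0"
  shows "smooth_on S (\<lambda>p. (F (p, Y p))\<^sup>2)"
proof -
  have "smooth_on S (\<lambda>p. F (p, Y p))"
  proof (rule smooth_on_compose[where f = "\<lambda>p. (p, Y p)" and g = F])
    show "smooth_on S (\<lambda>p. (p, Y p))"
      by (intro smooth_on_Pair smooth_on_bounded_linear bounded_linear_ident Y(1))
    show "smooth_on slit_TS2 F"
      using F by (simp add: finsler_metric_def)
    show "(\<lambda>p. (p, Y p)) ` S \<subseteq> slit_TS2"
      using S Y by (auto simp: slit_TS2_def)
  qed
  from smooth_on_scaleR[OF this this] show ?thesis
    by (simp add: power2_eq_square)
qed

lemma vector_field_through: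
  assumes "v \<in> tangent p"
  obtains W where "vector_field W" "W p = v"
proof (rule that)
  show "vector_field (\<lambda>q. \<Sum>i\<in>UNIV. (v $ i) *\<^sub>R frame i q)"
    unfolding sum_3 by (intro vector_field_add vector_field_scaleR smooth_on_const vector_field_frame)
qed (rule frame_expansion[OF assms])

text \<open>The metric comes from \<open>F\<^sup>2\<close> by polarisation. As \<open>F\<close> is smooth only off the zero section, smoothness of
  \<open>F\<^sup>2\<close> along a vector field \<open>Z\<close> with zeros needs an argument: near a given point, the parallelogram law
  expresses it by the values along \<open>Z + W\<close>, \<open>Z - W\<close> and \<open>W\<close>, where \<open>W\<close> is chosen so that these three fields
  have no zeros there.\<close>

lemma riemannian_if_quadratic:
  assumes F: "finsler_metric F"
    and quad: "\<And>p. p \<in> S2 \<Longrightarrow> \<exists>A \<alpha> \<beta> \<gamma>. tangent p \<subseteq> range (comb A) \<and> 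
      (\<forall>x y. (F (p, comb A (x, y)))\<^sup>2 = \<alpha> * x\<^sup>2 + \<beta> * (x * y) + \<gamma> * y\<^sup>2)"
    and pos: "\<And>p v. p \<in> S2 \<Longrightarrow> v \<in> tangent p \<Longrightarrow> v \<noteq> 0 \<Longrightarrow> F (p, v) > 0"
  shows "riemannian F"
proof -
  define g where "g p u w = ((F (p, u + w))\<^sup>2 - (F (p, u))\<^sup>2 - (F (p, w))\<^sup>2) / 2" for p u w
  have bil: "\<exists>A \<alpha> \<beta> \<gamma>. tangent p \<subseteq> range (comb A) \<and>
      (\<forall>x y. (F (p, comb A (x, y)))\<^sup>2 = \<alpha> * x\<^sup>2 + \<beta> * (x * y) + \<gamma> * y\<^sup>2) \<and>
      (\<forall>x y s t. g p (comb A (x, y)) (comb A (s, t)) = \<alpha> * (x * s) + \<beta> / 2 * (x * t + y * s) + \<gamma> * (y * t))"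
    if p: "p \<in> S2" for p
  proof -
    obtain A \<alpha> \<beta> \<gamma> where A: "tangent p \<subseteq> range (comb A)"
      and q: "\<And>x y. (F (p, comb A (x, y)))\<^sup>2 = \<alpha> * x\<^sup>2 + \<beta> * (x * y) + \<gamma> * y\<^sup>2"
      using quad[OF p] by metis
    have "comb A (x, y) + comb A (s, t) = comb A (x + s, y + t)" for x y s t
      by (simp add: comb_def algebra_simps)
    then have "g p (comb A (x, y)) (comb A (s, t)) = \<alpha> * (x * s) + \<beta> / 2 * (x * t + y * s) + \<gamma> * (y * t)"
      for x y s t
      unfolding g_def by (simp only: q) (simp add: field_simps power2_eq_square)
    then show ?thesis using A q by blast
  qed
  have diag: "g p v v = (F (p, v))\<^sup>2" if p: "p \<in> S2" and v: "v \<in> tangent p" for p v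
  proof -
    obtain A \<alpha> \<beta> \<gamma> where A: "tangent p \<subseteq> range (comb A)"
      "\<And>x y. (F (p, comb A (x, y)))\<^sup>2 = \<alpha> * x\<^sup>2 + \<beta> * (x * y) + \<gamma> * y\<^sup>2"
      "\<And>x y s t. g p (comb A (x, y)) (comb A (s, t)) = \<alpha> * (x * s) + \<beta> / 2 * (x * t + y * s) + \<gamma> * (y * t)"
      using bil[OF p] by metis
    obtain x y where "v = comb A (x, y)" using A(1) v by (metis imageE subsetD surj_pair)
    then show ?thesis by (simp add: A(2,3)) (simp add: algebra_simps power2_eq_square)
  qed
  have linear: "g p (c *\<^sub>R u + d *\<^sub>R v) w = c * g p u w + d * g p v w"
    if p: "p \<in> S2" and t: "u \<in> tangent p" "v \<in> tangent p" "w \<in> tangent p" for p u v w c d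
  proof -
    obtain A \<alpha> \<beta> \<gamma> where A: "tangent p \<subseteq> range (comb A)"
      "\<And>x y s t. g p (comb A (x, y)) (comb A (s, t)) = \<alpha> * (x * s) + \<beta> / 2 * (x * t + y * s) + \<gamma> * (y * t)"
      using bil[OF p] by metis
    obtain x1 y1 x2 y2 x3 y3 where *: "u = comb A (x1, y1)" "v = comb A (x2, y2)" "w = comb A (x3, y3)"
      using A(1) t by (metis imageE subsetD surj_pair)
    have "c *\<^sub>R u + d *\<^sub>R v = comb A (c * x1 + d * x2, c * y1 + d * y2)"
      by (simp add: * comb_def algebra_simps)
    then show ?thesis by (simp add: * A(2)) (simp add: field_simps)
  qed
  have parallelogram: "(F (p, v))\<^sup>2 = (1/2) * (F (p, v + w))\<^sup>2 + (1/2) * (F (p, v + (- 1) *\<^sub>R w))\<^sup>2 + (- 1) * (F (p, w))\<^sup>2"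
    if p: "p \<in> S2" and t: "v \<in> tangent p" "w \<in> tangent p" for p v w
  proof -
    obtain A \<alpha> \<beta> \<gamma> where A: "tangent p \<subseteq> range (comb A)"
      "\<And>x y. (F (p, comb A (x, y)))\<^sup>2 = \<alpha> * x\<^sup>2 + \<beta> * (x * y) + \<gamma> * y\<^sup>2"
      using bil[OF p] by metis
    obtain x1 y1 x2 y2 where *: "v = comb A (x1, y1)" "w = comb A (x2, y2)"
      using A(1) t by (metis imageE subsetD surj_pair)
    have s: "v + w = comb A (x1 + x2, y1 + y2)" and d: "v + (- 1) *\<^sub>R w = comb A (x1 - x2, y1 - y2)"
      by (simp_all add: * comb_def algebra_simps)
    show ?thesis unfolding s d unfolding * A(2) by (simp add: field_simps power2_eq_square)
  qed
  have smooth: "smooth_on S2 (\<lambda>p. (F (p, Z p))\<^sup>2)" if Z: "vector_field Z" for Z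
  proof (rule smooth_on_local)
    fix p assume p: "p \<in> S2"
    have Zp: "Z p \<in> tangent p" using Z p by (simp add: vector_field_def)
    obtain v where v: "v \<in> tangent p" "v \<noteq> 0" "Z p + v \<noteq> 0" "Z p + (-1) *\<^sub>R v \<noteq> 0"
    proof (cases "Z p = 0")
      case True
      obtain e where "e \<in> tangent p" "norm e = 1" by (rule tangent_nontrivial)
      moreover from this have "e \<noteq> 0" by auto
      ultimately show ?thesis using that[of e] True by simp
    next
      case False
      have plus: "Z p + 2 *\<^sub>R Z p = 3 *\<^sub>R Z p"
        using scaleR_left_distrib[of 1 2 "Z p"] by simp
      have minus: "Z p + (-1) *\<^sub>R (2 *\<^sub>R Z p) = (-1) *\<^sub>R Z p"
        using scaleR_left_distrib[of 1 "-2" "Z p"] by simp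
      show ?thesis
        by (rule that[of "2 *\<^sub>R Z p"]; (unfold plus minus)?)
          (use False subspace_scale[OF tangent_subspace Zp] in auto)
    qed
    obtain W where W: "vector_field W" "W p = v"
      using vector_field_through[OF v(1)] .
    have W': "vector_field (\<lambda>q. (-1) *\<^sub>R W q)"
      by (intro vector_field_scaleR smooth_on_const W(1))
    have nbhd: "\<exists>D. open D \<and> p \<in> D \<and> (\<forall>q\<in>S2 \<inter> D. Y q \<noteq> 0)"
      if "vector_field Y" "Y p \<noteq> 0" for Y :: "real^3 \<Rightarrow> real^3"
    proof -
      have "continuous_on S2 Y"
        using that(1) smooth_on_imp_continuous_on by (auto simp: vector_field_def)
      then have "openin (top_of_set S2) (S2 \<inter> Y -` (- {0}))"
        by (rule continuous_openin_preimage_gen) (simp add: open_Compl)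
      then obtain D where D: "open D" "S2 \<inter> Y -` (- {0}) = S2 \<inter> D"
        by (auto simp: openin_open)
      have "Y q \<noteq> 0 \<longleftrightarrow> q \<in> D" if "q \<in> S2" for q
        using D(2) that by blast
      then show ?thesis using D(1) p that(2) by blast
    qed
    obtain O1 where O1: "open O1" "p \<in> O1" "\<forall>q\<in>S2 \<inter> O1. W q \<noteq> 0"
      using nbhd[OF W(1)] v W(2) by auto
    obtain O2 where O2: "open O2" "p \<in> O2" "\<forall>q\<in>S2 \<inter> O2. Z q + W q \<noteq> 0"
      using nbhd[OF vector_field_add[OF Z W(1)]] v W(2) by auto
    obtain O3 where O3: "open O3" "p \<in> O3" "\<forall>q\<in>S2 \<inter> O3. Z q + (-1) *\<^sub>R W q \<noteq> 0"
      using nbhd[OF vector_field_add[OF Z W']] v W(2) by auto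
    define S where "S = S2 \<inter> (O1 \<inter> O2 \<inter> O3)"
    have sm: "smooth_on S (\<lambda>q. (F (q, Y q))\<^sup>2)"
      if "vector_field Y" "\<forall>q\<in>S. Y q \<noteq> 0" for Y
      using that by (intro smooth_on_finsler_field[OF F])
        (auto simp: S_def vector_field_def intro: smooth_on_subset)
    have "smooth_on S (\<lambda>q. (1/2) *\<^sub>R (F (q, Z q + W q))\<^sup>2 +
        (1/2) *\<^sub>R (F (q, Z q + (-1) *\<^sub>R W q))\<^sup>2 + (-1) *\<^sub>R (F (q, W q))\<^sup>2)"
      by (intro smooth_on_add smooth_on_scaleR smooth_on_const sm vector_field_add Z W(1) W')
        (use O1 O2 O3 in \<open>auto simp: S_def\<close>)
    then have "smooth_on S (\<lambda>q. (F (q, Z q))\<^sup>2)"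
    proof (rule smooth_on_cong)
      fix q assume "q \<in> S"
      then have "q \<in> S2" by (simp add: S_def)
      then show "(1/2) *\<^sub>R (F (q, Z q + W q))\<^sup>2 + (1/2) *\<^sub>R (F (q, Z q + (-1) *\<^sub>R W q))\<^sup>2 +
          (-1) *\<^sub>R (F (q, W q))\<^sup>2 = (F (q, Z q))\<^sup>2"
        using parallelogram[of q "Z q" "W q"] Z W(1) by (simp add: vector_field_def)
    qed
    then show "\<exists>D. open D \<and> p \<in> D \<and> smooth_on (S2 \<inter> D) (\<lambda>q. (F (q, Z q))\<^sup>2)"
      using O1 O2 O3 by (intro exI[of _ "O1 \<inter> O2 \<inter> O3"]) (auto simp: S_def)
  qed
  have "riemannian_metric g"
    unfolding riemannian_metric_def
  proof (intro conjI allI impI ballI)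
    fix p v w assume "p \<in> S2" "v \<in> tangent p" "w \<in> tangent p"
    show "g p v w = g p w v" by (simp add: g_def add.commute)
  next
    fix p v assume *: "p \<in> S2" "v \<in> tangent p" "v \<noteq> (0 :: real^3)"
    show "g p v v > 0" using pos[OF *] diag[OF *(1,2)] by simp
  next
    fix X Y assume "vector_field X \<and> vector_field Y"
    then have X: "vector_field X" and Y: "vector_field Y" by auto
    have "smooth_on S2 (\<lambda>p. (1/2) *\<^sub>R ((F (p, X p + Y p))\<^sup>2 + (-1) *\<^sub>R (F (p, X p))\<^sup>2 + (-1) *\<^sub>R (F (p, Y p))\<^sup>2))"
      by (intro smooth_on_scaleR smooth_on_add smooth_on_const smooth vector_field_add X Y)
    then show "smooth_on S2 (\<lambda>p. g p (X p) (Y p))"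
      by (simp add: g_def)
  qed (use linear in auto)
  moreover have "F (p, v) = sqrt (g p v v)" if "p \<in> S2" "v \<in> tangent p" for p v
    using diag[OF that] that F by (auto simp: finsler_metric_def TS2_def)
  ultimately show ?thesis
    unfolding riemannian_def TS2_def by blast
qed

section \<open>Parallel transport along great circles\<close>

lemma integral_Icc_diff_bound:
  fixes f :: "real \<Rightarrow> 'a::euclidean_space"
  assumes f: "continuous_on UNIV f" "\<And>t. norm (f t) \<le> C" and "a \<le> s" "a \<le> t"
  shows "norm (integral {a..s} f - integral {a..t} f) \<le> C * \<bar>s - t\<bar>"
proof -
  have *: "norm (integral {a..s} f - integral {a..t} f) \<le> C * \<bar>s - t\<bar>" if "a \<le> t" "t \<le> s" for s t
  proof -
    have "f integrable_on {a..s}"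
      by (intro integrable_continuous_real continuous_on_subset[OF f(1)]) auto
    then have "integral {a..t} f + integral {t..s} f = integral {a..s} f"
      using that by (intro Henstock_Kurzweil_Integration.integral_combine) auto
    then have "norm (integral {a..s} f - integral {a..t} f) = norm (integral {t..s} f)"
      by (metis add_diff_cancel_left')
    also have "\<dots> \<le> C * (s - t)"
      using that by (intro integral_bound continuous_on_subset[OF f(1)] f(2)) auto
    finally show ?thesis using that by simp
  qed
  show ?thesis
    using *[of t s] *[of s t] assms(3,4) by (cases "s \<le> t") (auto simp: norm_minus_commute abs_minus_commute)
qed

text \<open>The contraction principle for the integral equation. The length \<open>\<delta>\<close> of the interval depends only on the
  Lipschitz constant, so solutions can be continued over arbitrarily long intervals in equal steps.\<close>

lemma ode_local_solution:
  fixes B :: "real \<Rightarrow> 'a::euclidean_space \<Rightarrow> 'a"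
  assumes cont: "\<And>V. continuous_on UNIV V \<Longrightarrow> continuous_on UNIV (\<lambda>t. B t (V t))"
    and lip: "\<And>t v w. norm (B t v - B t w) \<le> K * norm (v - w)"
    and \<delta>: "\<delta> > 0" "K * \<delta> \<le> 1 / 2" and K: "K \<ge> 0"
  shows "\<exists>V. V t0 = v0 \<and> (\<forall>t\<in>ball t0 \<delta>. (V has_vector_derivative B t (V t)) (at t))"
proof -
  define a b where "a = t0 - \<delta>" and "b = t0 + \<delta>"
  \<comment> \<open>Functions on \<open>{a..b}\<close> are extended to the line by constants, which makes them bounded.\<close>
  define c where "c t = max a (min b t)" for t
  have c: "c t \<in> {a..b}" "\<bar>c t - t0\<bar> \<le> \<delta>" for t
    using \<delta>(1) by (auto simp: c_def a_def b_def max_def min_def)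
  have c_id: "c t = t" if "t \<in> {a..b}" for t
    using that by (auto simp: c_def)
  have t0: "t0 \<in> {a..b}" using \<delta>(1) by (auto simp: a_def b_def)
  define I where "I V t = integral {a..t} (\<lambda>s. B s (apply_bcontfun V s))" for V t
  define G where "G V t = v0 + (I V (c t) - I V t0)" for V t
  have contB: "continuous_on UNIV (\<lambda>s. B s (apply_bcontfun V s))" for V
    by (intro cont) auto
  have contI: "continuous_on {a..b} (I V)" for V
    unfolding I_def
    by (intro indefinite_integral_continuous_1 integrable_continuous_real
        continuous_on_subset[OF contB]) auto
  have G: "G V \<in> bcontfun" for V
  proof -
    have contc: "continuous_on UNIV c"
      unfolding c_def by (intro continuous_intros)
    have "continuous_on UNIV (G V)"
      unfolding G_def
      by (intro continuous_intros continuous_on_compose2[OF contI contc]) (use c in auto)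
    moreover have "bounded (range (G V))"
    proof (rule bounded_subset)
      show "bounded ((\<lambda>t. v0 + (I V t - I V t0)) ` {a..b})"
        by (intro compact_imp_bounded compact_continuous_image continuous_intros contI) auto
      show "range (G V) \<subseteq> (\<lambda>t. v0 + (I V t - I V t0)) ` {a..b}"
        using c(1) by (auto simp: G_def)
    qed
    ultimately show ?thesis by (simp add: bcontfun_def)
  qed
  have "\<exists>!V. Bcontfun (G V) = V"
  proof (rule banach_fix_type[of "1 / 2"])
    show "\<forall>V W. dist (Bcontfun (G V)) (Bcontfun (G W)) \<le> 1 / 2 * dist V W"
    proof (intro allI dist_bound)
      fix V W :: "real \<Rightarrow>\<^sub>C 'a" and t
      let ?D = "\<lambda>s. B s (apply_bcontfun V s) - B s (apply_bcontfun W s)"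
      have D: "norm (?D s) \<le> K * dist V W" for s
        using lip[of s "apply_bcontfun V s" "apply_bcontfun W s"] dist_bounded[of V s W] K
        by (metis dist_norm mult_left_mono order_trans)
      have int: "(\<lambda>s. B s (apply_bcontfun V s)) integrable_on {a..t}" for V t
        by (intro integrable_continuous_real continuous_on_subset[OF contB]) auto
      have "G V t - G W t = integral {a..c t} ?D - integral {a..t0} ?D"
        by (simp add: G_def I_def integral_diff int)
      then have "norm (G V t - G W t) \<le> K * dist V W * \<bar>c t - t0\<bar>"
        using integral_Icc_diff_bound[of ?D "K * dist V W" a "c t" t0] D c(1)[of t] t0
        by (simp add: continuous_on_diff contB)
      also have "\<dots> \<le> K * dist V W * \<delta>"
        using c(2)[of t] K by (intro mult_left_mono) auto
      also have "\<dots> = (K * \<delta>) * dist V W" by simp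
      also have "\<dots> \<le> 1 / 2 * dist V W"
        using \<delta>(2) by (intro mult_right_mono) auto
      finally show "dist (apply_bcontfun (Bcontfun (G V)) t) (apply_bcontfun (Bcontfun (G W)) t)
          \<le> 1 / 2 * dist V W"
        using G by (simp add: Bcontfun_inverse dist_norm)
    qed
  qed auto
  then obtain V where "Bcontfun (G V) = V" by blast
  then have V: "apply_bcontfun V t = G V t" for t
    using G by (metis Bcontfun_inverse)
  show ?thesis
  proof (intro exI[of _ "apply_bcontfun V"] conjI ballI)
    show "apply_bcontfun V t0 = v0"
      by (simp add: V G_def c_id[OF t0])
    fix t assume t: "t \<in> ball t0 \<delta>"
    then have tab: "t \<in> {a<..<b}"
      by (auto simp: a_def b_def dist_real_def)
    have "(I V has_vector_derivative B t (apply_bcontfun V t)) (at t within {a..b})"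
      unfolding I_def using tab
      by (intro integral_has_vector_derivative continuous_on_subset[OF contB]) auto
    then have "(I V has_vector_derivative B t (apply_bcontfun V t)) (at t)"
      using tab by (simp add: at_within_Icc_at)
    then have "((\<lambda>t. v0 + (I V t - I V t0)) has_vector_derivative B t (apply_bcontfun V t)) (at t)"
      by (auto intro!: derivative_eq_intros)
    then show "(apply_bcontfun V has_vector_derivative B t (apply_bcontfun V t)) (at t)"
      using tab by (elim has_vector_derivative_transform_within_open[where S = "{a<..<b}"])
        (use c_id in \<open>auto simp: V G_def\<close>)
  qed
qed

text \<open>A bootstrap argument for \<open>V' = G\<close>, where \<open>G\<close> is as smooth as \<open>V\<close>.\<close>

lemma Ck_on_ode_solution:
  fixes V :: "real \<Rightarrow> 'a::euclidean_space"
  assumes I: "open I" and V: "\<And>t. t \<in> I \<Longrightarrow> (V has_vector_derivative G t) (at t)"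
    and step: "\<And>k. Ck_on k I V \<Longrightarrow> Ck_on k I G"
  shows "Ck_on k I V"
proof (induction k)
  case 0
  show ?case
    using V by (auto intro!: continuous_at_imp_continuous_on has_vector_derivative_continuous)
next
  case (Suc k)
  have D: "(V has_derivative (\<lambda>h. h *\<^sub>R G t)) (at t)" if "t \<in> I" for t
    using V[OF that] by (simp add: has_vector_derivative_def)
  have "Ck_on k I (\<lambda>t. frechet_derivative V (at t) h)" for h
  proof -
    have "Ck_on k I (\<lambda>t. h *\<^sub>R G t)"
      by (intro Ck_on_linear_comp[OF I bounded_linear_scaleR_right] step Suc)
    then show ?thesis
      by (subst Ck_on_cong[OF I]) (auto simp: frechet_derivative_at[OF D, symmetric])
  qed
  then show ?case using D by (auto simp: differentiable_def)
qed

lemma sum_frame: "(\<Sum>i\<in>UNIV. (w $ i) *\<^sub>R frame i p) = w - (w \<bullet> p) *\<^sub>R p"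
proof -
  have "(\<Sum>i\<in>UNIV. (w $ i) *\<^sub>R frame i p) =
      (\<Sum>i\<in>UNIV. (w $ i) *\<^sub>R axis i 1) - (\<Sum>i\<in>UNIV. (w $ i) * (p $ i)) *\<^sub>R p"
    by (simp add: frame_def scaleR_diff_right sum_subtractf scaleR_sum_left)
  moreover have "(\<Sum>i\<in>UNIV. (w $ i) *\<^sub>R axis i (1::real)) = w"
    using basis_expansion[of w] by (simp add: scalar_mult_eq_scaleR)
  ultimately show ?thesis by (simp add: inner_vec_def)
qed

text \<open>Along the great circle \<open>\<gamma>\<close>, parallel transport over any parameter length below \<open>\<delta>\<close> carries a pair of tangent
  vectors to a pair whose linear combinations have the same Finslerian lengths. The velocity of \<open>\<gamma>\<close> is the restriction of the vector
  field \<open>X\<close> of a rotation, so the coefficients \<open>C i\<close> of the equation are smooth along the curve and bounded.\<close>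

lemma great_circle_step:
  assumes nabla: "linear_connection nabla" and comp: "compatible nabla F"
    and p0: "p0 \<in> S2" and u: "u \<in> tangent p0" "norm u = 1"
  defines "\<gamma> \<equiv> \<lambda>t. cos t *\<^sub>R p0 + sin t *\<^sub>R u"
  shows "\<exists>\<delta>>0. \<forall>t s a b. 0 < s \<and> s < \<delta> \<and> a \<in> tangent (\<gamma> t) \<and> b \<in> tangent (\<gamma> t) \<longrightarrow>
    (\<exists>a'\<in>tangent (\<gamma> (t + s)). \<exists>b'\<in>tangent (\<gamma> (t + s)). \<forall>x y.
      F (\<gamma> (t + s), x *\<^sub>R a' + y *\<^sub>R b') = F (\<gamma> t, x *\<^sub>R a + y *\<^sub>R b))"
proof -
  define X where "X p = (p \<bullet> p0) *\<^sub>R u + (- (p \<bullet> u)) *\<^sub>R p0" for p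
  define \<gamma>' where "\<gamma>' t = cos t *\<^sub>R u - sin t *\<^sub>R p0" for t
  have inner: "p0 \<bullet> p0 = 1" "u \<bullet> u = 1" "p0 \<bullet> u = 0" "u \<bullet> p0 = 0"
    using p0 u by (auto simp: norm_eq_1 tangent_def inner_commute)
  have cs: "cos t * cos t + sin t * sin t = 1" for t :: real
    using sin_cos_squared_add[of t] by (simp add: power2_eq_square)
  have \<gamma>1: "\<gamma> t \<bullet> \<gamma> t = 1" for t
    by (simp add: \<gamma>_def inner_add_left inner_add_right inner cs)
  have \<gamma>S2: "\<gamma> t \<in> S2" for t
    using \<gamma>1 by (simp add: norm_eq_1)
  have X\<gamma>: "X (\<gamma> t) = \<gamma>' t" for t
    by (simp add: X_def \<gamma>_def \<gamma>'_def inner_add_left inner)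
  have \<gamma>der: "(\<gamma> has_vector_derivative \<gamma>' t) (at t)" for t
    unfolding \<gamma>_def \<gamma>'_def by (auto intro!: derivative_eq_intros simp: has_vector_derivative_def fun_eq_iff algebra_simps)
  have \<gamma>'der: "(\<gamma>' has_vector_derivative - \<gamma> t) (at t)" for t
    unfolding \<gamma>_def \<gamma>'_def by (auto intro!: derivative_eq_intros simp: has_vector_derivative_def fun_eq_iff algebra_simps)
  \<comment> \<open>\<open>(\<gamma>, \<gamma>')\<close> solves a linear system, so it is smooth.\<close>
  have pair: "Ck_on k UNIV (\<lambda>t. (\<gamma> t, \<gamma>' t))" for k
  proof (rule Ck_on_ode_solution[where G = "\<lambda>t. (\<gamma>' t, - \<gamma> t)"])
    show "((\<lambda>t. (\<gamma> t, \<gamma>' t)) has_vector_derivative (\<gamma>' t, - \<gamma> t)) (at t)" for t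
      by (intro has_vector_derivative_Pair \<gamma>der \<gamma>'der)
    fix k assume "Ck_on k UNIV (\<lambda>t. (\<gamma> t, \<gamma>' t))"
    moreover have "bounded_linear (\<lambda>z :: (real^3) \<times> (real^3). (snd z, - fst z))"
      by (intro bounded_linear_Pair bounded_linear_snd bounded_linear_minus bounded_linear_fst)
    ultimately show "Ck_on k UNIV (\<lambda>t. (\<gamma>' t, - \<gamma> t))"
      using Ck_on_linear_comp[of UNIV "\<lambda>z :: (real^3) \<times> (real^3). (snd z, - fst z)" k "\<lambda>t. (\<gamma> t, \<gamma>' t)"] by simp
  qed auto
  have \<gamma>C: "Ck_on k UNIV \<gamma>" and \<gamma>'C: "Ck_on k UNIV \<gamma>'" for k
    using Ck_on_linear_comp[OF open_UNIV bounded_linear_fst pair[of k]]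
      Ck_on_linear_comp[OF open_UNIV bounded_linear_snd pair[of k]] by auto
  have X: "vector_field X"
  proof -
    have "smooth_on S2 X"
      unfolding X_def
      by (intro smooth_on_add smooth_on_scaleR smooth_on_const smooth_on_bounded_linear
          bounded_linear_minus bounded_linear_inner_left)
    moreover have "X p \<in> tangent p" for p
      by (simp add: X_def tangent_def inner_diff_right)
    ultimately show ?thesis by (simp add: vector_field_def)
  qed
  define C where "C i t = nabla (frame i) (\<gamma> t) (\<gamma>' t)" for i t
  have "\<forall>X Y. vector_field X \<and> vector_field Y \<longrightarrow> smooth_on S2 (\<lambda>p. nabla Y p (X p))"
    using nabla unfolding linear_connection_def by (elim conjE)
  then have smC: "smooth_on S2 (\<lambda>p. nabla (frame i) p (X p))" for i
    using X vector_field_frame by simp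
  have CC: "Ck_on k UNIV (C i)" for k i
  proof -
    have "smooth_on UNIV \<gamma>" using \<gamma>C by (simp add: smooth_on_open_iff)
    then have "smooth_on UNIV (\<lambda>t. nabla (frame i) (\<gamma> t) (X (\<gamma> t)))"
      by (rule smooth_on_compose[OF _ smC]) (use \<gamma>S2 in auto)
    then show ?thesis
      by (simp add: smooth_on_open_iff X\<gamma> C_def[abs_def])
  qed
  have Ctan: "C i t \<in> tangent (\<gamma> t)" for i t
  proof -
    have "\<gamma>' t \<in> tangent (\<gamma> t)" using X \<gamma>S2[of t] by (simp add: vector_field_def X\<gamma>[symmetric])
    moreover have "\<forall>Y p v. vector_field Y \<and> p \<in> S2 \<and> v \<in> tangent p \<longrightarrow> nabla Y p v \<in> tangent p"
      using nabla unfolding linear_connection_def by (elim conjE)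
    ultimately show ?thesis
      using \<gamma>S2[of t] vector_field_frame by (simp add: C_def)
  qed
  have "\<exists>K. \<forall>t. norm (C i t) \<le> K" for i
  proof -
    have "bounded ((\<lambda>p. nabla (frame i) p (X p)) ` S2)"
      by (intro compact_imp_bounded compact_continuous_image smooth_on_imp_continuous_on smC) auto
    then obtain K where "\<forall>p\<in>S2. norm (nabla (frame i) p (X p)) \<le> K"
      by (auto simp: bounded_iff)
    then show ?thesis using \<gamma>S2 X\<gamma> unfolding C_def by metis
  qed
  then obtain k where k: "\<And>i t. norm (C i t) \<le> k i" by metis
  have k0: "k i \<ge> 0" for i using k[of i 0] norm_ge_zero order_trans by blast
  define K where "K = 1 + (\<Sum>i\<in>UNIV. k i)"
  have K: "K \<ge> 1" by (simp add: K_def sum_nonneg k0)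
  \<comment> \<open>For \<open>V\<close> tangent along \<open>\<gamma>\<close>, the sum \<open>\<Sum>i. V\<^sub>i' frame i\<close> in the covariant derivative is
    \<open>V' + (V \<bullet> \<gamma>') \<gamma>\<close>. Conversely, solutions of \<open>V' = B t V\<close> that start tangent remain so.\<close>
  define B where "B t v = (- (v \<bullet> \<gamma>' t)) *\<^sub>R \<gamma> t + (- 1) *\<^sub>R (\<Sum>i\<in>UNIV. (v $ i) *\<^sub>R C i t)" for t v
  have Bsm: "Ck_on k I (\<lambda>t. B t (V t))" if I: "open I" and V: "Ck_on k I V" for k I V
  proof -
    have nth: "Ck_on k I (\<lambda>t. V t $ i)" for i
      by (rule Ck_on_linear_comp[OF I bounded_linear_vec_nth V])
    have "Ck_on k I (\<lambda>t. (V t $ i) *\<^sub>R (\<gamma>' t $ i))" for i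
      by (intro Ck_on_scaleR I nth Ck_on_linear_comp[OF I bounded_linear_vec_nth] Ck_on_subset[OF \<gamma>'C]) auto
    then have "Ck_on k I (\<lambda>t. - (\<Sum>i\<in>UNIV. (V t $ i) *\<^sub>R (\<gamma>' t $ i)))"
      by (intro Ck_on_linear_comp[OF I bounded_linear_minus[OF bounded_linear_ident]] Ck_on_sum I) auto
    then have "Ck_on k I (\<lambda>t. - (V t \<bullet> \<gamma>' t))"
      by (simp add: inner_vec_def)
    then show ?thesis
      unfolding B_def
      by (intro Ck_on_add Ck_on_scaleR Ck_on_sum Ck_on_const I nth) (auto intro: Ck_on_subset[OF \<gamma>C] Ck_on_subset[OF CC])
  qed
  have Blin: "B t (x *\<^sub>R v + y *\<^sub>R w) = x *\<^sub>R B t v + y *\<^sub>R B t w" for t x y v w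
    by (simp add: B_def sum_3 inner_add_left algebra_simps)
  have \<gamma>'1: "norm (\<gamma>' t) = 1" for t
    by (simp add: norm_eq_1 \<gamma>'_def inner_diff_left inner_diff_right inner cs)
  have Bbound: "norm (B t v) \<le> K * norm v" for t v
  proof -
    have "norm ((- (v \<bullet> \<gamma>' t)) *\<^sub>R \<gamma> t) \<le> norm v"
      using Cauchy_Schwarz_ineq2[of v "\<gamma>' t"] \<gamma>'1[of t] \<gamma>S2[of t] by simp
    moreover have "norm ((- 1) *\<^sub>R (\<Sum>i\<in>UNIV. (v $ i) *\<^sub>R C i t)) \<le> (\<Sum>i\<in>UNIV. k i) * norm v"
    proof -
      have "norm (\<Sum>i\<in>UNIV. (v $ i) *\<^sub>R C i t) \<le> (\<Sum>i\<in>UNIV. norm v * k i)"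
        using component_le_norm_cart[of v] k k0
        by (intro sum_norm_le) (auto intro!: mult_mono)
      then show ?thesis by (simp add: sum_distrib_left[symmetric] mult.commute)
    qed
    moreover have "norm (B t v) \<le> norm ((- (v \<bullet> \<gamma>' t)) *\<^sub>R \<gamma> t) +
        norm ((- 1) *\<^sub>R (\<Sum>i\<in>UNIV. (v $ i) *\<^sub>R C i t))"
      unfolding B_def by (rule norm_triangle_ineq)
    moreover have "K * norm v = norm v + (\<Sum>i\<in>UNIV. k i) * norm v"
      by (simp add: K_def distrib_right)
    ultimately show ?thesis by linarith
  qed
  have Blip: "norm (B t v - B t w) \<le> K * norm (v - w)" for t v w
    using Bbound[of t "v - w"] Blin[of t 1 v "-1" w] by simp
  define \<delta> where "\<delta> = 1 / (2 * K)"
  have \<delta>: "\<delta> > 0" "K * \<delta> \<le> 1 / 2" using K by (auto simp: \<delta>_def)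
  have sol: "\<exists>V. V t0 = v0 \<and> (\<forall>t\<in>ball t0 \<delta>. (V has_vector_derivative B t (V t)) (at t))" for t0 v0
    by (rule ode_local_solution[OF _ Blip \<delta>]) (use K Bsm[of UNIV 0] in auto)
  have transport: "V (t + s) \<in> tangent (\<gamma> (t + s)) \<and> F (\<gamma> (t + s), V (t + s)) = F (\<gamma> t, V t)"
    if V: "\<And>\<tau>. \<tau> \<in> ball t \<delta> \<Longrightarrow> (V has_vector_derivative B \<tau> (V \<tau>)) (at \<tau>)"
      and Vt: "V t \<in> tangent (\<gamma> t)" and s: "0 < s" "s < \<delta>" for V t s
  proof -
    have tan: "V \<tau> \<bullet> \<gamma> \<tau> = 0" if \<tau>: "\<tau> \<in> ball t \<delta>" for \<tau>
    proof -
      have "((\<lambda>\<tau>. V \<tau> \<bullet> \<gamma> \<tau>) has_derivative (\<lambda>h. 0)) (at \<tau> within ball t \<delta>)" if \<tau>: "\<tau> \<in> ball t \<delta>" for \<tau>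
      proof -
        have "C i \<tau> \<bullet> \<gamma> \<tau> = 0" for i
          using Ctan[of i \<tau>] by (simp add: tangent_def inner_commute)
        then have "V \<tau> \<bullet> \<gamma>' \<tau> + B \<tau> (V \<tau>) \<bullet> \<gamma> \<tau> = 0"
          by (simp add: B_def inner_add_left inner_diff_left inner_sum_left \<gamma>1)
        moreover have "((\<lambda>\<tau>. V \<tau> \<bullet> \<gamma> \<tau>) has_derivative (\<lambda>h. V \<tau> \<bullet> (h *\<^sub>R \<gamma>' \<tau>) + (h *\<^sub>R B \<tau> (V \<tau>)) \<bullet> \<gamma> \<tau>)) (at \<tau>)"
          using V[OF \<tau>] \<gamma>der[of \<tau>] unfolding has_vector_derivative_def by (rule has_derivative_inner)
        ultimately have "((\<lambda>\<tau>. V \<tau> \<bullet> \<gamma> \<tau>) has_derivative (\<lambda>h. 0)) (at \<tau>)"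
          by (simp flip: distrib_left)
        then show ?thesis by (rule has_derivative_at_withinI)
      qed
      then obtain c where c: "\<And>\<tau>. \<tau> \<in> ball t \<delta> \<Longrightarrow> V \<tau> \<bullet> \<gamma> \<tau> = c"
        using has_derivative_zero_constant[of "ball t \<delta>" "\<lambda>\<tau>. V \<tau> \<bullet> \<gamma> \<tau>"] by auto
      have "c = 0" using c[of t] \<delta>(1) Vt by (simp add: tangent_def inner_commute)
      then show ?thesis using c[OF \<tau>] by simp
    qed
    have sub: "{t..t + s} \<subseteq> ball t \<delta>" using s by (auto simp: dist_real_def)
    have "smooth_on (ball t \<delta>) V"
      using Ck_on_ode_solution[of "ball t \<delta>" V "\<lambda>\<tau>. B \<tau> (V \<tau>)"] V Bsm[of "ball t \<delta>"]
      by (simp add: smooth_on_open_iff)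
    then have field: "field_along t (t + s) \<gamma> V"
      unfolding field_along_def using sub tan by (auto intro: smooth_on_subset simp: tangent_def inner_commute)
    have curve: "smooth_curve t (t + s) \<gamma>"
      unfolding smooth_curve_def using s \<gamma>S2 \<gamma>C
      by (auto simp: smooth_on_open_iff intro: smooth_on_subset[of UNIV])
    have "covariant_derivative_along nabla t (t + s) \<gamma> V \<tau> = 0" if \<tau>: "\<tau> \<in> {t..t + s}" for \<tau>
    proof -
      have dV: "vector_derivative V (at \<tau> within {t..t + s}) = B \<tau> (V \<tau>)"
        using V[of \<tau>] \<tau> sub s by (intro vector_derivative_at_within_ivl) auto
      have d\<gamma>: "vector_derivative \<gamma> (at \<tau> within {t..t + s}) = \<gamma>' \<tau>"
        using \<gamma>der[of \<tau>] \<tau> sub s by (intro vector_derivative_at_within_ivl) auto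
      have "covariant_derivative_along nabla t (t + s) \<gamma> V \<tau> =
          (B \<tau> (V \<tau>) - (B \<tau> (V \<tau>) \<bullet> \<gamma> \<tau>) *\<^sub>R \<gamma> \<tau>) + (\<Sum>i\<in>UNIV. (V \<tau> $ i) *\<^sub>R C i \<tau>)"
        by (simp add: covariant_derivative_along_def dV d\<gamma> sum.distrib sum_frame C_def)
      moreover have "C i \<tau> \<bullet> \<gamma> \<tau> = 0" for i
        using Ctan[of i \<tau>] by (simp add: tangent_def inner_commute)
      then have "B \<tau> (V \<tau>) \<bullet> \<gamma> \<tau> = - (V \<tau> \<bullet> \<gamma>' \<tau>)"
        by (simp add: B_def inner_add_left inner_diff_left inner_sum_left \<gamma>1)
      ultimately show ?thesis by (simp add: B_def)
    qed
    then have "parallel_transport nabla t (t + s) \<gamma> (V t) (V (t + s))"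
      using field unfolding parallel_transport_def parallel_along_def by blast
    then have "F (\<gamma> (t + s), V (t + s)) = F (\<gamma> t, V t)"
      using comp curve unfolding compatible_def by blast
    moreover have "V (t + s) \<in> tangent (\<gamma> (t + s))"
      using tan[of "t + s"] s by (simp add: tangent_def inner_commute dist_real_def)
    ultimately show ?thesis by simp
  qed
  show ?thesis
  proof (intro exI[of _ \<delta>] conjI allI impI \<delta>(1))
    fix t s a b
    assume "0 < s \<and> s < \<delta> \<and> a \<in> tangent (\<gamma> t) \<and> b \<in> tangent (\<gamma> t)"
    then have s: "0 < s" "s < \<delta>" and ab: "a \<in> tangent (\<gamma> t)" "b \<in> tangent (\<gamma> t)" by auto
    obtain V where V: "V t = a" "\<And>\<tau>. \<tau> \<in> ball t \<delta> \<Longrightarrow> (V has_vector_derivative B \<tau> (V \<tau>)) (at \<tau>)"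
      using sol[of t a] by auto
    obtain W where W: "W t = b" "\<And>\<tau>. \<tau> \<in> ball t \<delta> \<Longrightarrow> (W has_vector_derivative B \<tau> (W \<tau>)) (at \<tau>)"
      using sol[of t b] by auto
    have "F (\<gamma> (t + s), x *\<^sub>R V (t + s) + y *\<^sub>R W (t + s)) = F (\<gamma> t, x *\<^sub>R a + y *\<^sub>R b)" for x y
    proof -
      have "((\<lambda>\<tau>. x *\<^sub>R V \<tau> + y *\<^sub>R W \<tau>) has_vector_derivative B \<tau> (x *\<^sub>R V \<tau> + y *\<^sub>R W \<tau>)) (at \<tau>)"
        if "\<tau> \<in> ball t \<delta>" for \<tau>
        using V(2)[OF that] W(2)[OF that] unfolding Blin
        by (auto intro!: derivative_eq_intros)
      moreover have "x *\<^sub>R V t + y *\<^sub>R W t \<in> tangent (\<gamma> t)"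
        using ab V(1) W(1) by (simp add: tangent_def inner_add_right)
      ultimately show ?thesis
        using transport[of t "\<lambda>\<tau>. x *\<^sub>R V \<tau> + y *\<^sub>R W \<tau>" s] s V(1) W(1) by simp
    qed
    moreover have "V (t + s) \<in> tangent (\<gamma> (t + s))" "W (t + s) \<in> tangent (\<gamma> (t + s))"
      using transport[OF V(2) _ s] transport[OF W(2) _ s] V(1) W(1) ab by auto
    ultimately show "\<exists>a'\<in>tangent (\<gamma> (t + s)). \<exists>b'\<in>tangent (\<gamma> (t + s)). \<forall>x y.
        F (\<gamma> (t + s), x *\<^sub>R a' + y *\<^sub>R b') = F (\<gamma> t, x *\<^sub>R a + y *\<^sub>R b)"
      by blast
  qed
qed

lemma great_circle_through:
  assumes p0: "p0 \<in> S2" and p: "p \<in> S2"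
  obtains u \<theta> where "u \<in> tangent p0" "norm u = 1" "\<theta> \<ge> 0" "p = cos \<theta> *\<^sub>R p0 + sin \<theta> *\<^sub>R u"
proof -
  define c where "c = p \<bullet> p0"
  define w where "w = p - c *\<^sub>R p0"
  have pp: "p \<bullet> p = 1" "p0 \<bullet> p0 = 1" using p p0 by (auto simp: norm_eq_1)
  have w: "w \<in> tangent p0"
    by (simp add: tangent_def w_def inner_diff_right pp c_def inner_commute)
  obtain u where u: "u \<in> tangent p0" "norm u = 1" "w = norm w *\<^sub>R u"
  proof (cases "w = 0")
    case True
    obtain e where "e \<in> tangent p0" "norm e = 1" by (rule tangent_nontrivial)
    then show ?thesis using that[of e] True by simp
  next
    case False
    then show ?thesis
      using that[of "(1 / norm w) *\<^sub>R w"] subspace_scale[OF tangent_subspace w] by simp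
  qed
  have "c\<^sup>2 + (norm w)\<^sup>2 = 1"
    unfolding power2_norm_eq_inner
    by (simp add: w_def inner_diff_left inner_diff_right pp inner_commute[of p0 p] power2_eq_square
        flip: c_def)
  then obtain \<theta> where "0 \<le> \<theta>" "c = cos \<theta>" "norm w = sin \<theta>"
    using sincos_total_pi[of "norm w" c] by auto
  moreover from this have "p = cos \<theta> *\<^sub>R p0 + sin \<theta> *\<^sub>R u"
    using u(3) by (simp add: w_def algebra_simps)
  ultimately show ?thesis using that u by blast
qed

text \<open>Every point is reached from \<open>p0\<close> along a great circle in finitely many steps of parallel transport.\<close>

lemma isometric_frame_exists:
  assumes nabla: "linear_connection nabla" and comp: "compatible nabla F"
    and p0: "p0 \<in> S2" and ab: "fst A \<in> tangent p0" "snd A \<in> tangent p0" and p: "p \<in> S2"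
  shows "\<exists>A'. fst A' \<in> tangent p \<and> snd A' \<in> tangent p \<and> (\<forall>u. F (p, comb A' u) = F (p0, comb A u))"
proof -
  obtain u \<theta> where u: "u \<in> tangent p0" "norm u = 1" and \<theta>: "\<theta> \<ge> 0" "p = cos \<theta> *\<^sub>R p0 + sin \<theta> *\<^sub>R u"
    using great_circle_through[OF p0 p] .
  define \<gamma> where "\<gamma> t = cos t *\<^sub>R p0 + sin t *\<^sub>R u" for t
  obtain \<delta> where \<delta>: "\<delta> > 0" "\<And>t s a b. 0 < s \<Longrightarrow> s < \<delta> \<Longrightarrow> a \<in> tangent (\<gamma> t) \<Longrightarrow> b \<in> tangent (\<gamma> t) \<Longrightarrow>
      \<exists>a'\<in>tangent (\<gamma> (t + s)). \<exists>b'\<in>tangent (\<gamma> (t + s)). \<forall>x y.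
        F (\<gamma> (t + s), x *\<^sub>R a' + y *\<^sub>R b') = F (\<gamma> t, x *\<^sub>R a + y *\<^sub>R b)"
    using great_circle_step[OF nabla comp p0 u] unfolding \<gamma>_def by metis
  show ?thesis
  proof (cases "\<theta> = 0")
    case True
    then have "p = p0" using \<theta>(2) by simp
    then show ?thesis using ab by blast
  next
    case False
    then obtain n where n: "\<theta> / \<delta> < real n"
      using reals_Archimedean2 by blast
    have n0: "n > 0"
      using n \<theta>(1) \<delta>(1) False by (cases n) (auto simp: field_simps)
    define s where "s = \<theta> / real n"
    have s: "0 < s" "s < \<delta>"
      using n n0 \<theta>(1) \<delta>(1) False by (auto simp: s_def field_simps)
    have "\<exists>A'. fst A' \<in> tangent (\<gamma> (real k * s)) \<and> snd A' \<in> tangent (\<gamma> (real k * s)) \<and>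
        (\<forall>v. F (\<gamma> (real k * s), comb A' v) = F (p0, comb A v))" for k
    proof (induction k)
      case 0
      have "\<gamma> (real 0 * s) = p0" by (simp add: \<gamma>_def)
      then show ?case using ab by metis
    next
      case (Suc k)
      then obtain A' where A': "fst A' \<in> tangent (\<gamma> (real k * s))" "snd A' \<in> tangent (\<gamma> (real k * s))"
        "\<And>v. F (\<gamma> (real k * s), comb A' v) = F (p0, comb A v)"
        by blast
      have eq: "real k * s + s = real (Suc k) * s" by (simp add: algebra_simps)
      obtain a' b' where *: "a' \<in> tangent (\<gamma> (real (Suc k) * s))" "b' \<in> tangent (\<gamma> (real (Suc k) * s))"
        "\<And>x y. F (\<gamma> (real (Suc k) * s), x *\<^sub>R a' + y *\<^sub>R b') =
          F (\<gamma> (real k * s), x *\<^sub>R fst A' + y *\<^sub>R snd A')"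
        using \<delta>(2)[OF s A'(1,2)] unfolding eq by blast
      have "F (\<gamma> (real (Suc k) * s), comb (a', b') v) = F (p0, comb A v)" for v
        using *(3)[of "fst v" "snd v"] A'(3)[of v] by (simp add: comb_def)
      then show ?case using * by (intro exI[of _ "(a', b')"]) simp
    qed
    from this[of n] show ?thesis
      using n0 \<theta>(2) by (simp add: s_def \<gamma>_def)
  qed
qed

section \<open>The covering by isometric frames\<close>

text \<open>The space of isometric frames: pairs \<open>A\<close> of tangent vectors at a point \<open>p\<close> for which the linear map \<open>comb A\<close>
  carries the gauge \<open>N\<close> on the plane to \<open>F\<close> on the tangent plane. The base point is the first component.\<close>

definition iso_frames ::
  "((real^3) \<times> (real^3) \<Rightarrow> real) \<Rightarrow> (real \<times> real \<Rightarrow> real) \<Rightarrow> ((real^3) \<times> ((real^3) \<times> (real^3))) set" where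
  "iso_frames F N = {(p, A). p \<in> S2 \<and> fst A \<in> tangent p \<and> snd A \<in> tangent p \<and>
     (\<forall>u. F (p, comb A u) = N u)}"

lemma compact_iso_frames:
  assumes F: "finsler_metric F"
  shows "compact (iso_frames F N)"
proof -
  define K :: "((real^3) \<times> ((real^3) \<times> (real^3))) set"
    where "K = {z. norm (fst z) = 1} \<inter> {z. fst z \<bullet> fst (snd z) = 0} \<inter> {z. fst z \<bullet> snd (snd z) = 0}"
  have K: "closed K"
    unfolding K_def by (intro closed_Int closed_Collect_eq continuous_intros)
  have KTS2: "(fst z, comb (snd z) u) \<in> TS2" if "z \<in> K" for z u
    using that by (auto simp: TS2_def K_def tangent_def comb_def inner_add_right)
  have eq: "iso_frames F N = (\<Inter>u. {z \<in> K. F (fst z, comb (snd z) u) = N u})"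
    by (auto simp: iso_frames_def K_def tangent_def)
  have "closed {z \<in> K. F (fst z, comb (snd z) u) = N u}" for u
  proof (rule continuous_closed_preimage_constant[OF _ K])
    have cont: "continuous_on K (\<lambda>z. (fst z, comb (snd z) u))"
      unfolding comb_def by (intro continuous_intros)
    have "continuous_on TS2 F"
      using F by (simp add: finsler_metric_def)
    from continuous_on_compose2[OF this cont]
    show "continuous_on K (\<lambda>z. F (fst z, comb (snd z) u))"
      using KTS2 by blast
  qed
  then have "closed (iso_frames F N)"
    unfolding eq by (intro closed_INT) auto
  moreover have "bounded (iso_frames F N)"
  proof -
    obtain c C where c: "c > 0" "C > 0"
      "\<And>p v. p \<in> S2 \<Longrightarrow> v \<in> tangent p \<Longrightarrow> c * norm v \<le> F (p, v) \<and> F (p, v) \<le> C * norm v"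
      using finsler_bounds[OF F] by blast
    have "iso_frames F N \<subseteq> cball 0 1 \<times> (cball 0 (N (1, 0) / c) \<times> cball 0 (N (0, 1) / c))"
    proof (clarsimp simp: iso_frames_def)
      fix p a b assume *: "norm p = 1" "a \<in> tangent p" "b \<in> tangent p"
        "\<forall>x y. F (p, comb (a, b) (x, y)) = N (x, y)"
      have "F (p, a) = N (1, 0)" "F (p, b) = N (0, 1)"
        using *(4)[rule_format, of 1 0] *(4)[rule_format, of 0 1] by auto
      then have "c * norm a \<le> N (1, 0)" "c * norm b \<le> N (0, 1)"
        using c(3)[of p a] c(3)[of p b] * by auto
      then show "norm a \<le> N (1, 0) / c \<and> norm b \<le> N (0, 1) / c"
        using c(1) by (simp add: field_simps)
    qed
    then show ?thesis
      by (rule bounded_subset[rotated]) (intro bounded_Times bounded_cball)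
  qed
  ultimately show ?thesis by (simp add: compact_eq_bounded_closed)
qed

text \<open>Two frames at the same point differ by a symmetry of \<open>N\<close>. Together with \<open>iso_frames_symmetry\<close>, this says
  that the symmetries act simply transitively on the frames at a point.\<close>

lemma iso_frames_transition:
  assumes pos: "\<And>u. u \<noteq> 0 \<Longrightarrow> N u > 0" and F: "finsler_metric F"
    and C: "(p, C) \<in> iso_frames F N" and A: "(p, A) \<in> iso_frames F N"
  obtains M where "A = (comb C (fst M), comb C (snd M))" "\<And>u. N (comb M u) = N u"
proof -
  have C': "p \<in> S2" "fst C \<in> tangent p" "snd C \<in> tangent p" "\<And>u. F (p, comb C u) = N u"
    using C by (auto simp: iso_frames_def)
  have A': "fst A \<in> tangent p" "snd A \<in> tangent p" "\<And>u. F (p, comb A u) = N u"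
    using A by (auto simp: iso_frames_def)
  have "u = 0" if "comb C u = 0" for u
    using C'(4)[of u] pos[of u] finsler_zero[OF F C'(1)] that by auto
  then have "tangent p \<subseteq> range (comb C)"
    by (rule tangent_subset_range_comb[OF C'(1-3)])
  then obtain m1 m2 where m: "fst A = comb C m1" "snd A = comb C m2"
    using A' by (meson imageE subsetD)
  show ?thesis
  proof (rule that[of "(m1, m2)"])
    show eq: "A = (comb C (fst (m1, m2)), comb C (snd (m1, m2)))"
      using m by (simp add: prod_eq_iff)
    show "N (comb (m1, m2) u) = N u" for u
    proof -
      have "N (comb (m1, m2) u) = F (p, comb C (comb (m1, m2) u))"
        by (simp add: C'(4))
      also have "\<dots> = F (p, comb A u)"
        by (simp only: comb_comb eq)
      finally show ?thesis by (simp add: A'(3))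
    qed
  qed
qed

lemma iso_frames_symmetry:
  assumes "(p, C) \<in> iso_frames F N" "\<And>u. N (comb M u) = N u"
  shows "(p, (comb C (fst M), comb C (snd M))) \<in> iso_frames F N"
proof -
  have C: "p \<in> S2" "fst C \<in> tangent p" "snd C \<in> tangent p" "\<And>u. F (p, comb C u) = N u"
    using assms(1) by (auto simp: iso_frames_def)
  have "F (p, comb (comb C (fst M), comb C (snd M)) u) = N u" for u
    by (simp only: comb_comb[symmetric] C(4) assms(2))
  then show ?thesis
    using C(1) comb_in_tangent[OF C(2,3)] by (simp add: iso_frames_def)
qed

text \<open>Frames can be moved to nearby base points with little change, uniformly. If not, then by compactness there
  are frames \<open>x\<^sub>n\<close> that converge to a frame \<open>X\<close>, and frames \<open>z\<^sub>n\<close> at the base points to which \<open>x\<^sub>n\<close> cannot be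
  moved, which converge to a frame \<open>Z\<close> at the same point as \<open>X\<close>. The symmetry that carries \<open>Z\<close> to \<open>X\<close>
  carries the \<open>z\<^sub>n\<close> to frames close to \<open>x\<^sub>n\<close>.\<close>

lemma iso_frames_lift:
  assumes F: "finsler_metric F" and pos: "\<And>u. u \<noteq> 0 \<Longrightarrow> N u > 0"
    and onto: "fst ` iso_frames F N = S2" and e: "e > 0"
  shows "\<exists>r>0. \<forall>x\<in>iso_frames F N. \<forall>b\<in>S2. dist b (fst x) < r \<longrightarrow>
    (\<exists>y\<in>iso_frames F N. fst y = b \<and> dist y x < e)"
proof (rule ccontr)
  let ?E = "iso_frames F N"
  assume neg: "\<not> ?thesis"
  have "\<exists>x b. x \<in> ?E \<and> b \<in> S2 \<and> dist b (fst x) < 1 / real (Suc n) \<and>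
      (\<forall>y\<in>?E. fst y = b \<longrightarrow> e \<le> dist y x)" for n
  proof -
    have "1 / real (Suc n) > 0" by simp
    then show ?thesis using neg by (meson not_less)
  qed
  then obtain x b where xb: "\<And>n. x n \<in> ?E" "\<And>n. b n \<in> S2"
    "\<And>n. dist (b n) (fst (x n)) < 1 / real (Suc n)"
    "\<And>n y. y \<in> ?E \<Longrightarrow> fst y = b n \<Longrightarrow> e \<le> dist y (x n)"
    by metis
  have "\<exists>z. z \<in> ?E \<and> fst z = b n" for n
    using onto xb(2)[of n] by (metis imageE)
  then obtain z where z: "\<And>n. z n \<in> ?E" "\<And>n. fst (z n) = b n"
    by metis
  have "seq_compact (?E \<times> ?E)"
    by (intro compact_imp_seq_compact compact_Times compact_iso_frames F)
  moreover have "\<forall>n. (x n, z n) \<in> ?E \<times> ?E" using xb(1) z(1) by simp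
  ultimately obtain l s where l: "l \<in> ?E \<times> ?E" "strict_mono s" "((\<lambda>n. (x n, z n)) \<circ> s) \<longlonglongrightarrow> l"
    by (rule seq_compactE[where f = "\<lambda>n. (x n, z n)"])
  define X Z where "X = fst l" and "Z = snd l"
  have X: "(\<lambda>n. x (s n)) \<longlonglongrightarrow> X" and Z: "(\<lambda>n. z (s n)) \<longlonglongrightarrow> Z"
    using tendsto_fst[OF l(3)] tendsto_snd[OF l(3)] by (simp_all add: X_def Z_def o_def)
  have XZ: "X \<in> ?E" "Z \<in> ?E" using l(1) by (auto simp: X_def Z_def)
  have "(\<lambda>n. dist (b n) (fst (x n))) \<longlonglongrightarrow> 0"
  proof (rule tendsto_sandwich[of "\<lambda>n. 0" _ _ "\<lambda>n. 1 / real (Suc n)"])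
    show "(\<lambda>n. 1 / real (Suc n)) \<longlonglongrightarrow> 0"
      using LIMSEQ_inverse_real_of_nat by (simp add: inverse_eq_divide)
  qed (use xb(3) in \<open>auto intro!: always_eventually less_imp_le simp del: of_nat_Suc\<close>)
  then have "(\<lambda>n. dist (fst (z (s n))) (fst (x (s n)))) \<longlonglongrightarrow> 0"
    using LIMSEQ_subseq_LIMSEQ[OF _ l(2)] by (simp add: z(2) o_def)
  moreover have "(\<lambda>n. dist (fst (z (s n))) (fst (x (s n)))) \<longlonglongrightarrow> dist (fst Z) (fst X)"
    by (intro tendsto_intros X Z)
  ultimately have "dist (fst Z) (fst X) = 0"
    by (rule LIMSEQ_unique[rotated])
  then have fst_eq: "fst Z = fst X" by simp
  have Z': "(fst X, snd Z) \<in> ?E" and X': "(fst X, snd X) \<in> ?E"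
    using XZ by (simp_all flip: fst_eq) (simp add: fst_eq)
  obtain M where M: "snd X = (comb (snd Z) (fst M), comb (snd Z) (snd M))" "\<And>u. N (comb M u) = N u"
    using iso_frames_transition[OF pos F Z' X'] by blast
  define y where "y n = (b (s n), (comb (snd (z (s n))) (fst M), comb (snd (z (s n))) (snd M)))" for n
  have "y n \<in> ?E" for n
  proof -
    have "(b (s n), snd (z (s n))) \<in> ?E" using z(1)[of "s n"] by (simp flip: z(2))
    then show ?thesis unfolding y_def by (rule iso_frames_symmetry[where N = N and M = M, OF _ M(2)])
  qed
  then have far: "e \<le> dist (y n) (x (s n))" for n
    using xb(4)[of "y n" "s n"] by (simp add: y_def)
  have "(\<lambda>n. dist (y n) (x (s n))) \<longlonglongrightarrow>
      dist (fst Z, (comb (snd Z) (fst M), comb (snd Z) (snd M))) X"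
    unfolding y_def comb_def z(2)[symmetric] by (intro tendsto_intros X Z)
  also have "(fst Z, (comb (snd Z) (fst M), comb (snd Z) (snd M))) = X"
    using fst_eq M(1) by (simp add: prod_eq_iff)
  finally have "(\<lambda>n. dist (y n) (x (s n))) \<longlonglongrightarrow> 0" by simp
  then have "e \<le> 0"
    by (rule tendsto_lowerbound) (use far in auto)
  then show False using e by simp
qed

text \<open>If the identity is isolated among the symmetries of \<open>N\<close>, then distinct frames at the same point have at least a
  fixed distance.\<close>

lemma iso_frames_separated:
  assumes F: "finsler_metric F" and pos: "\<And>u. u \<noteq> 0 \<Longrightarrow> N u > 0"
    and c: "c > 0" "\<And>u. c * norm u \<le> N u"
    and iso: "\<eta> > 0" "\<And>M. (\<And>u. N (comb M u) = N u) \<Longrightarrow> norm (M - ((1, 0), (0, 1))) < \<eta> \<Longrightarrow> M = ((1, 0), (0, 1))"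
  shows "\<exists>d>0. \<forall>x\<in>iso_frames F N. \<forall>y\<in>iso_frames F N. fst x = fst y \<longrightarrow> dist x y < d \<longrightarrow> x = y"
proof -
  obtain k K where K: "k > 0" "K > 0"
    "\<And>p v. p \<in> S2 \<Longrightarrow> v \<in> tangent p \<Longrightarrow> k * norm v \<le> F (p, v) \<and> F (p, v) \<le> K * norm v"
    using finsler_bounds[OF F] by blast
  define d where "d = \<eta> * c / (2 * K)"
  have "x = y" if x: "x \<in> iso_frames F N" and y: "y \<in> iso_frames F N" and eq: "fst x = fst y"
    and d: "dist x y < d" for x y
  proof -
    define p C A where "p = fst x" and "C = snd x" and "A = snd y"
    have xy: "x = (p, C)" "y = (p, A)" using eq by (simp_all add: p_def C_def A_def prod_eq_iff)
    obtain M where M: "A = (comb C (fst M), comb C (snd M))" "\<And>u. N (comb M u) = N u"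
      using iso_frames_transition[where N = N, OF pos F] x y unfolding xy by metis
    have C: "p \<in> S2" "fst C \<in> tangent p" "snd C \<in> tangent p" "\<And>u. F (p, comb C u) = N u"
      using x by (auto simp: iso_frames_def xy)
    have AC: "dist x y = norm (A - C)"
      by (simp add: xy dist_Pair_Pair dist_norm norm_minus_commute)
    have le: "c * norm (w - v) \<le> K * norm (comb C w - comb C v)" for v w
    proof -
      have "c * norm (w - v) \<le> F (p, comb C (w - v))"
        using c(2)[of "w - v"] C(4) by simp
      also have "\<dots> \<le> K * norm (comb C (w - v))"
        using K(3)[OF C(1) comb_in_tangent[OF C(2,3)]] by blast
      finally show ?thesis by (simp add: linear_diff[OF linear_comb])
    qed
    have parts: "norm (fst A - fst C) \<le> norm (A - C)" "norm (snd A - snd C) \<le> norm (A - C)"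
      using norm_fst_le[of "fst (A - C)" "snd (A - C)"] norm_snd_le[of "snd (A - C)" "fst (A - C)"]
      unfolding prod.collapse by simp_all
    have "c * norm (fst M - (1, 0)) \<le> K * norm (fst A - fst C)"
      using le[of "fst M" "(1, 0)"] by (simp add: M(1))
    also have "\<dots> \<le> K * norm (A - C)"
      using parts(1) K(2) by simp
    finally have "c * norm (fst M - (1, 0)) \<le> K * norm (A - C)" .
    moreover have "c * norm (snd M - (0, 1)) \<le> K * norm (snd A - snd C)"
      using le[of "snd M" "(0, 1)"] by (simp add: M(1))
    then have "c * norm (snd M - (0, 1)) \<le> K * norm (A - C)"
      using mult_left_mono[OF parts(2), of K] K(2) by linarith
    moreover have "norm (M - ((1, 0), (0, 1))) \<le> norm (fst M - (1, 0)) + norm (snd M - (0, 1))"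
      using norm_Pair_le[of "fst M - (1, 0)" "snd M - (0, 1)"] by (simp add: minus_prod_def)
    then have "c * norm (M - ((1, 0), (0, 1))) \<le> c * norm (fst M - (1, 0)) + c * norm (snd M - (0, 1))"
      using c(1) by (simp flip: distrib_left)
    moreover have "2 * K * norm (A - C) < \<eta> * c"
      using d K(2) unfolding AC d_def by (simp add: field_simps)
    ultimately have "c * norm (M - ((1, 0), (0, 1))) < c * \<eta>"
      by (simp add: algebra_simps)
    then have "M = ((1, 0), (0, 1))"
      using iso(2)[OF M(2)] c(1) by simp
    then show ?thesis
      using M(1) by (simp add: xy)
  qed
  moreover have "d > 0" using iso(1) c(1) K(2) by (simp add: d_def)
  ultimately show ?thesis by blast
qed

lemma compatible_connection_imp_riemannian:
  assumes F: "finsler_metric F" and nabla: "linear_connection nabla" and comp: "compatible nabla F"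
  shows "riemannian F"
proof (rule ccontr)
  assume not_riem: "\<not> riemannian F"
  define p0 :: "real^3" where "p0 = axis 3 1"
  define A0 :: "(real^3) \<times> (real^3)" where "A0 = (axis 1 1, axis 2 1)"
  have p0: "p0 \<in> S2" by (simp add: p0_def norm_axis_1)
  have A0: "fst A0 \<in> tangent p0" "snd A0 \<in> tangent p0"
    by (simp_all add: A0_def p0_def tangent_def inner_axis_axis)
  have norm_A0: "norm (comb A0 u) = norm u" for u
    by (cases u) (simp add: comb_def A0_def norm_eq_sqrt_inner inner_add_left inner_add_right inner_axis_axis)
  define N where "N u = F (p0, comb A0 u)" for u
  have inj0: "u = 0" if "comb A0 u = 0" for u
    using norm_A0[of u] that by simp
  have tan0: "comb A0 u \<in> tangent p0" for u
    by (rule comb_in_tangent[OF A0])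
  have N_pos: "N u > 0" if "u \<noteq> 0" for u
    unfolding N_def using finsler_pos[OF F p0 tan0] inj0 that by blast
  have N_hom: "N (t *\<^sub>R u) = t * N u" if "t > 0" for t u
    using finsler_hom[OF F p0 tan0 that, of u] by (simp add: N_def linear_scale[OF linear_comb])
  have N_diff: "N differentiable (at u)" if "u \<noteq> 0" for u
    unfolding N_def[abs_def] by (rule finsler_differentiable[OF F p0 A0 inj0 that])
  let ?E = "iso_frames F N"
  have exE: "\<exists>A. (p, A) \<in> ?E" if p: "p \<in> S2" for p
    using isometric_frame_exists[OF nabla comp p0 A0 p] p by (auto simp: iso_frames_def N_def)
  have onto: "fst ` ?E = S2"
  proof
    show "S2 \<subseteq> fst ` ?E" using exE by force
  qed (auto simp: iso_frames_def)
  \<comment> \<open>The first case: if \<open>N\<^sup>2\<close> is a quadratic form, so is \<open>F\<^sup>2\<close> on every tangent plane, and \<open>F\<close> is Riemannian.\<close>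
  have not_quad: "\<not> (\<exists>\<alpha> \<beta> \<gamma>. \<forall>x y. (N (x, y))\<^sup>2 = \<alpha> * x\<^sup>2 + \<beta> * (x * y) + \<gamma> * y\<^sup>2)"
  proof
    assume "\<exists>\<alpha> \<beta> \<gamma>. \<forall>x y. (N (x, y))\<^sup>2 = \<alpha> * x\<^sup>2 + \<beta> * (x * y) + \<gamma> * y\<^sup>2"
    then obtain \<alpha> \<beta> \<gamma> where q: "\<And>x y. (N (x, y))\<^sup>2 = \<alpha> * x\<^sup>2 + \<beta> * (x * y) + \<gamma> * y\<^sup>2"
      by blast
    have "riemannian F"
    proof (rule riemannian_if_quadratic[OF F])
      fix p assume p: "p \<in> S2"
      obtain A where A: "fst A \<in> tangent p" "snd A \<in> tangent p" "\<And>u. F (p, comb A u) = N u"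
        using exE[OF p] by (auto simp: iso_frames_def)
      have "u = 0" if "comb A u = 0" for u
        using A(3)[of u] N_pos[of u] finsler_zero[OF F p] that by auto
      then have "tangent p \<subseteq> range (comb A)"
        by (rule tangent_subset_range_comb[OF p A(1,2)])
      then show "\<exists>A \<alpha> \<beta> \<gamma>. tangent p \<subseteq> range (comb A) \<and>
          (\<forall>x y. (F (p, comb A (x, y)))\<^sup>2 = \<alpha> * x\<^sup>2 + \<beta> * (x * y) + \<gamma> * y\<^sup>2)"
        using A(3) q by (intro exI[of _ A] exI[of _ \<alpha>] exI[of _ \<beta>] exI[of _ \<gamma>]) simp
    qed (rule finsler_pos[OF F])
    then show False using not_riem by simp
  qed
  \<comment> \<open>The second case: the identity is isolated among the symmetries of \<open>N\<close>.\<close>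
  have "\<exists>\<eta>>0. \<forall>M. (\<forall>u. N (comb M u) = N u) \<longrightarrow> norm (M - ((1, 0), (0, 1))) < \<eta> \<longrightarrow> M = ((1, 0), (0, 1))"
  proof (rule ccontr)
    assume neg: "\<not> ?thesis"
    have "\<exists>M. (\<forall>u. N (comb M u) = N u) \<and> norm (M - ((1, 0), (0, 1))) < 1 / real (Suc n) \<and> M \<noteq> ((1, 0), (0, 1))" for n
    proof -
      have "1 / real (Suc n) > 0" by simp
      then show ?thesis using neg by blast
    qed
    then obtain M where M: "\<And>n u. N (comb (M n) u) = N u"
      "\<And>n. norm (M n - ((1, 0), (0, 1))) < 1 / real (Suc n)" "\<And>n. M n \<noteq> ((1, 0), (0, 1))"
      by metis
    have "(\<lambda>n. norm (M n - ((1, 0), (0, 1)))) \<longlonglongrightarrow> 0"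
    proof (rule tendsto_sandwich[of "\<lambda>n. 0" _ _ "\<lambda>n. 1 / real (Suc n)"])
      show "(\<lambda>n. 1 / real (Suc n)) \<longlonglongrightarrow> 0"
        using LIMSEQ_inverse_real_of_nat by (simp add: inverse_eq_divide)
    qed (use M(2) in \<open>auto intro!: always_eventually less_imp_le simp del: of_nat_Suc\<close>)
    then have "M \<longlonglongrightarrow> ((1, 0), (0, 1))"
      by (simp add: LIM_zero_iff tendsto_norm_zero_iff)
    then show False
      using gauge_quadratic_if_symmetries_accumulate[where N = N and M = M, OF N_hom N_pos N_diff M(1,3)] not_quad by blast
  qed
  then obtain \<eta> where \<eta>: "\<eta> > 0" "\<And>M. (\<And>u. N (comb M u) = N u) \<Longrightarrow>
      norm (M - ((1, 0), (0, 1))) < \<eta> \<Longrightarrow> M = ((1, 0), (0, 1))"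
    by blast
  obtain c C where c: "c > 0" "C > 0"
    "\<And>p v. p \<in> S2 \<Longrightarrow> v \<in> tangent p \<Longrightarrow> c * norm v \<le> F (p, v) \<and> F (p, v) \<le> C * norm v"
    using finsler_bounds[OF F] by blast
  have cN: "c * norm u \<le> N u" for u
    using c(3)[OF p0 tan0, of u] by (simp add: N_def norm_A0)
  obtain d where d: "d > 0" "\<And>x y. x \<in> ?E \<Longrightarrow> y \<in> ?E \<Longrightarrow> fst x = fst y \<Longrightarrow> dist x y < d \<Longrightarrow> x = y"
    using iso_frames_separated[where N = N, OF F N_pos c(1) cN \<eta>] by blast
  \<comment> \<open>A section of the covering is a lift of the identity map.\<close>
  have cov: "covering_space ?E fst S2"
    by (rule covering_space_separated_fibres[OF _ onto d iso_frames_lift[where N = N, OF F N_pos onto]])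
      (auto intro: continuous_intros)
  have "simply_connected S2"
    by (rule simply_connected_sphere) simp
  moreover have "locally path_connected S2"
    by (rule locally_path_connected_sphere)
  ultimately obtain g where g: "continuous_on S2 g" "g \<in> S2 \<rightarrow> ?E" "\<And>p. p \<in> S2 \<Longrightarrow> fst (g p) = p"
    using covering_space_lift[OF cov, of S2 "\<lambda>p. p"] continuous_on_id by blast
  have gE: "(p, snd (g p)) \<in> ?E" if "p \<in> S2" for p
    using g(2) g(3)[OF that] that by (metis PiE prod.collapse)
  have "continuous_on S2 (\<lambda>p. fst (snd (g p)))"
    by (intro continuous_intros g(1))
  moreover have "fst (snd (g p)) \<in> tangent p" if "p \<in> S2" for p
    using gE[OF that] by (simp add: iso_frames_def)
  ultimately obtain p where p: "p \<in> S2" "fst (snd (g p)) = 0"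
    using hairy_ball by blast
  have "N (1, 0) = F (p, comb (snd (g p)) (1, 0))"
    using gE[OF p(1)] by (simp add: iso_frames_def del: comb_basis)
  then have "N (1, 0) = 0"
    using p finsler_zero[OF F p(1)] by simp
  then show False using N_pos[of "(1, 0)"] by (simp add: zero_prod_def)
qed

theorem corollary5:
  shows "\<not> (\<exists>F nabla. finsler_metric F \<and> \<not> riemannian F \<and>
           linear_connection nabla \<and> compatible nabla F)"
  using compatible_connection_imp_riemannian by blast

end
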